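(* Let $1<q<p$, $q<N$, let $\Omega\subset\mathbb R^N$ be an exterior domain and let $1<s<q_*:=\frac{q(N-1)}{N-q}$. Then the only nonnegative solution of $$-\Delta_p u-\Delta_q u\ge u^{s-1}\quad\text{in }\Omega$$ is $u\equiv 0$.
   Context: For $r>1$, $\Delta_r u=\operatorname{div}(|\nabla u|^{r-2}\nabla u)$. An exterior domain is a domain (connected open set) $\Omega\subset\mathbb R^N$ with $\Omega\supset\{x:|x|>R\}$ for some $R>0$. A nonnegative solution of $-\Delta_p u-\Delta_q u\ge u^{s-1}$ in $\Omega$ is a function $u\in C(\Omega)\cap W^{1,p}_{loc}(\Omega)$, $u\ge0$, such that $$\int_\Omega |\nabla u|^{p-2}\nabla u\cdot\nabla\varphi\,dx+\int_\Omega |\nabla u|^{q-2}\nabla u\cdot\nabla\varphi\,dx\ge \int_\Omega u^{s-1}\varphi\,dx\quad\text{for all }\varphi\in C^1_c(\Omega),\ \varphi\ge 0.$$ *)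

theory Defs
  imports "HOL-Analysis.Analysis"
begin

definition exterior_domain :: "'a::euclidean_space set \<Rightarrow> bool" where
  "exterior_domain \<Omega> \<longleftrightarrow>
     open \<Omega> \<and> connected \<Omega> \<and> (\<exists>R>0. {x. R < norm x} \<subseteq> \<Omega>)"

definition grad :: "('a::euclidean_space \<Rightarrow> real) \<Rightarrow> 'a \<Rightarrow> 'a" where
  "grad \<phi> x = (THE d. GDERIV \<phi> x :> d)"

lemma GDERIV_imp_grad: "GDERIV \<phi> x :> d \<Longrightarrow> grad \<phi> x = d"
  unfolding grad_def
proof (rule the_equality)
  fix e assume "GDERIV \<phi> x :> d" "GDERIV \<phi> x :> e"
  then have "(\<lambda>h. h \<bullet> e) = (\<lambda>h. h \<bullet> d)"
    unfolding gderiv_def by (rule has_derivative_unique[rotated])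
  then show "e = d"
    by (metis inner_commute vector_eq_ldot)
qed

lemma differentiable_imp_GDERIV_grad:
  assumes "\<phi> differentiable (at x)"
  shows "GDERIV \<phi> x :> grad \<phi> x"
proof -
  obtain D where D: "(\<phi> has_derivative D) (at x)"
    using assms by (auto simp: differentiable_def)
  have lin: "linear D"
    using D by (rule has_derivative_linear)
  have "D = (\<lambda>h. h \<bullet> adjoint D 1)"
    using adjoint_works[OF lin, of _ 1] by (auto simp: fun_eq_iff)
  with D have "GDERIV \<phi> x :> adjoint D 1"
    by (simp add: gderiv_def)
  then show ?thesis
    by (simp add: GDERIV_imp_grad)
qed

text \<open>The space \<open>C\<^sup>1\<^sub>c(\<Omega>)\<close>; its elements are extended by zero to the whole space.\<close>

definition C1c :: "'a::euclidean_space set \<Rightarrow> ('a \<Rightarrow> real) set" where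
  "C1c \<Omega> = {\<phi>. (\<forall>x. \<phi> differentiable (at x)) \<and> continuous_on UNIV (grad \<phi>) \<and>
               (\<exists>K. compact K \<and> K \<subseteq> \<Omega> \<and> (\<forall>x. x \<notin> K \<longrightarrow> \<phi> x = 0))}"

definition Lp_loc ::
  "real \<Rightarrow> 'a::euclidean_space set \<Rightarrow> ('a \<Rightarrow> 'b::euclidean_space) set" where
  "Lp_loc p \<Omega> = {f. f \<in> borel_measurable (lebesgue_on \<Omega>) \<and>
     (\<forall>K. compact K \<and> K \<subseteq> \<Omega> \<longrightarrow> integrable (lebesgue_on K) (\<lambda>x. norm (f x) powr p))}"

text \<open>Integration by parts in all coordinates at once, as an identity between vectors.\<close>

definition weak_gradient ::
  "'a::euclidean_space set \<Rightarrow> ('a \<Rightarrow> real) \<Rightarrow> ('a \<Rightarrow> 'a) \<Rightarrow> bool" where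
  "weak_gradient \<Omega> u G \<longleftrightarrow> u \<in> Lp_loc 1 \<Omega> \<and> G \<in> Lp_loc 1 \<Omega> \<and>
     (\<forall>\<phi>\<in>C1c \<Omega>. (LINT x:\<Omega>|lebesgue. u x *\<^sub>R grad \<phi> x) =
               - (LINT x:\<Omega>|lebesgue. \<phi> x *\<^sub>R G x))"

definition W1p_loc :: "real \<Rightarrow> 'a::euclidean_space set \<Rightarrow> ('a \<Rightarrow> real) set" where
  "W1p_loc p \<Omega> = {u. u \<in> Lp_loc p \<Omega> \<and> (\<exists>G\<in>Lp_loc p \<Omega>. weak_gradient \<Omega> u G)}"

text \<open>The weak form of \<open>-\<Delta>\<^sub>r u\<close> tested against \<open>\<phi>\<close>, where \<open>G\<close> is the weak gradient of \<open>u\<close>.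
  Where \<open>G x = 0\<close> the integrand vanishes, also for \<open>r < 2\<close>.\<close>

definition laplacian_form ::
  "real \<Rightarrow> 'a::euclidean_space set \<Rightarrow> ('a \<Rightarrow> 'a) \<Rightarrow> ('a \<Rightarrow> real) \<Rightarrow> real" where
  "laplacian_form r \<Omega> G \<phi> =
     (LINT x:\<Omega>|lebesgue. (norm (G x) powr (r - 2) *\<^sub>R G x) \<bullet> grad \<phi> x)"

text \<open>The weak gradient is unique up to null sets, so the existential quantifier over \<open>G\<close>
  just names it. For \<open>1 < q < p\<close> and \<open>s > 1\<close> all integrands are integrable. Values of
  \<open>u\<close> outside \<open>\<Omega>\<close> play no role.\<close>

definition nonneg_solution ::
  "real \<Rightarrow> real \<Rightarrow> real \<Rightarrow> 'a::euclidean_space set \<Rightarrow> ('a \<Rightarrow> real) \<Rightarrow> bool" where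
  "nonneg_solution p q s \<Omega> u \<longleftrightarrow>
     continuous_on \<Omega> u \<and> u \<in> W1p_loc p \<Omega> \<and> (\<forall>x\<in>\<Omega>. 0 \<le> u x) \<and>
     (\<exists>G\<in>Lp_loc p \<Omega>. weak_gradient \<Omega> u G \<and>
        (\<forall>\<phi>\<in>C1c \<Omega>. (\<forall>x\<in>\<Omega>. 0 \<le> \<phi> x) \<longrightarrow>
           laplacian_form p \<Omega> G \<phi> + laplacian_form q \<Omega> G \<phi>
             \<ge> (LINT x:\<Omega>|lebesgue. u x powr (s - 1) * \<phi> x)))"

end

theory Submission
  imports Defs
begin

text \<open>
  That \<open>u = 0\<close> is a solution is immediate. For the converse, all estimates come from comparing a
  nonnegative solution \<open>u\<close> with radial barriers \<open>A + B |x - x0|\<^sup>t\<close>. The operator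
  \<open>-\<Delta>\<^sub>p - \<Delta>\<^sub>q\<close> is not homogeneous, but for a pure power each of the two terms is an explicit power, and
  barriers that are strict subsolutions for both terms at once are available. Strictness is affordable
  because the bound on \<open>s\<close> is strict, and it makes the comparison principle
  (\<open>comparison_principle\<close>) elementary: its test function is built from a mollification of \<open>u\<close>, and
  monotonicity of the flux does the rest.

  Suppose that \<open>u\<close> is not identically zero. Decreasing barriers on annuli around a point show that \<open>u\<close> is
  positive throughout \<open>\<Omega>\<close> (\<open>strong_maximum_principle\<close>), and on annuli around the origin they show that
  \<open>u\<close> is at least of order \<open>|x|\<close> to the power \<open>-\<beta>\<close>, for every \<open>\<beta>\<close> above the decay rate
  \<open>(N - q) / (q - 1)\<close> of the fundamental solution (\<open>grows_like_initial\<close>). The right-hand side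
  \<open>u\<^sup>s\<^sup>-\<^sup>1\<close> then acts as a source, and comparison with torsion-like barriers on balls of radius \<open>|x0| / 2\<close>
  improves the exponent of the lower bound (\<open>grows_like_step\<close>). Below the critical value of \<open>s\<close> the
  improvement is bounded away from zero until the exponent exceeds 1. Superlinear growth is impossible,
  because the functions \<open>B (|x| - R)\<close> are subsolutions for every slope \<open>B\<close>
  (\<open>not_grows_like_superlinear\<close>).
\<close>

section \<open>Compactly supported functions and integration by parts\<close>

lemma integrable_continuous_compact_support:
  fixes f :: "'a::euclidean_space \<Rightarrow> 'b::euclidean_space"
  assumes "continuous_on UNIV f" "compact K" "\<And>x. x \<notin> K \<Longrightarrow> f x = 0"
  shows "integrable lborel f"
proof -
  have "(\<lambda>x. indicator K x *\<^sub>R f x) = f"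
    using assms(3) by (auto simp: fun_eq_iff indicator_def)
  moreover have "integrable lborel (\<lambda>x. indicator K x *\<^sub>R f x)"
    by (intro borel_integrable_compact assms(2) continuous_on_subset[OF assms(1)]) auto
  ultimately show ?thesis by simp
qed

lemma integral_shift:
  fixes f :: "'a::euclidean_space \<Rightarrow> 'b::{banach, second_countable_topology}"
  assumes [measurable]: "f \<in> borel_measurable borel"
  shows "(LINT x|lborel. f (c + x)) = (LINT x|lborel. f x)"
proof -
  have "(LINT x|lborel. f (c + x)) = (LINT x|distr lborel borel ((+) c). f x)"
    by (subst integral_distr) auto
  then show ?thesis by (simp only: lborel_distr_plus)
qed

lemma GDERIV_outside_support:
  fixes \<phi> :: "'a::euclidean_space \<Rightarrow> real"
  assumes "GDERIV \<phi> x :> D" "closed K" "\<And>x. x \<notin> K \<Longrightarrow> \<phi> x = 0" "x \<notin> K"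
  shows "D = 0"
proof -
  have "((\<lambda>_. 0) has_derivative (\<lambda>h. h \<bullet> 0)) (at x)" by simp
  then have "GDERIV \<phi> x :> 0"
    unfolding gderiv_def
    by (rule has_derivative_transform_within_open[where s="-K"]) (use assms in auto)
  then show ?thesis using assms(1) GDERIV_imp_grad by metis
qed

lemma GDERIV_transform_open:
  assumes "GDERIV f x :> D" "open S" "x \<in> S" "\<And>y. y \<in> S \<Longrightarrow> f y = g y"
  shows "GDERIV g x :> D"
  using has_derivative_transform_within_open[of f _ x UNIV S g] assms unfolding gderiv_def by auto

lemma GDERIV_isCont: "GDERIV f x :> D \<Longrightarrow> isCont f x"
  unfolding gderiv_def by (rule has_derivative_continuous)

lemma GDERIV_bounded_imp_Lipschitz:
  fixes \<phi> :: "'a::euclidean_space \<Rightarrow> real"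
  assumes "\<And>x. GDERIV \<phi> x :> D x" "\<And>x. norm (D x) \<le> M"
  shows "norm (\<phi> x - \<phi> y) \<le> M * norm (x - y)"
proof (rule differentiable_bound[where S=UNIV and f' = "\<lambda>x h. h \<bullet> D x"])
  fix x :: 'a
  show "(\<phi> has_derivative (\<lambda>h. h \<bullet> D x)) (at x within UNIV)"
    using assms(1) by (simp add: gderiv_def)
  show "onorm (\<lambda>h. h \<bullet> D x) \<le> M"
  proof (rule onorm_le)
    fix h
    have "norm (h \<bullet> D x) \<le> norm (D x) * norm h"
      using Cauchy_Schwarz_ineq2[of h "D x"] by (simp add: mult.commute)
    also have "\<dots> \<le> M * norm h" using assms(2)[of x] by (rule mult_right_mono) simp
    finally show "norm (h \<bullet> D x) \<le> M * norm h" .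
  qed
qed auto

text \<open>The difference quotients of \<open>\<phi>\<close> in direction \<open>b\<close> all have integral zero by translation
  invariance, and the bound on the gradient dominates them by a constant on a compact set.\<close>

lemma integral_GDERIV_eq_0:
  fixes \<phi> :: "'a::euclidean_space \<Rightarrow> real"
  assumes D: "\<And>x. GDERIV \<phi> x :> D x" and M: "\<And>x. norm (D x) \<le> M"
    and K: "compact K" "\<And>x. x \<notin> K \<Longrightarrow> \<phi> x = 0"
  shows "integrable lborel (\<lambda>x. b \<bullet> D x)" "(LINT x|lborel. b \<bullet> D x) = 0"
proof -
  define h where "h n = inverse (real (Suc n))" for n
  define Q where "Q n x = (\<phi> (h n *\<^sub>R b + x) - \<phi> x) / h n" for n x
  have h: "0 < h n" "h n \<le> 1" for n by (auto simp: h_def field_simps)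
  have cont: "continuous_on UNIV \<phi>"
    using D GDERIV_isCont continuous_at_imp_continuous_on by blast
  have [measurable]: "\<phi> \<in> borel_measurable borel" using cont by (rule borel_measurable_continuous_onI)
  have int: "integrable lborel \<phi>"
    using integrable_continuous_compact_support[OF cont K] .
  have int': "integrable lborel (\<lambda>x. \<phi> (c + x))" for c
  proof -
    have "integrable (distr lborel borel ((+) c)) \<phi>" using int by (simp only: lborel_distr_plus)
    then show ?thesis by (subst (asm) integrable_distr_eq) auto
  qed
  have Q0: "(LINT x|lborel. Q n x) = 0" for n
    unfolding Q_def using int int' integral_shift[of \<phi>] by simp
  have lim: "(\<lambda>n. Q n x) \<longlonglongrightarrow> b \<bullet> D x" for x
  proof -
    have "((\<lambda>t. \<phi> (x + t *\<^sub>R b)) has_derivative (\<lambda>t. (t *\<^sub>R b) \<bullet> D x)) (at 0)"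
      using D[of x, unfolded gderiv_def]
      by (intro has_derivative_compose[where f="\<lambda>t. x + t *\<^sub>R b" and g=\<phi> and g'="\<lambda>h. h \<bullet> D x"])
         (auto intro!: derivative_eq_intros)
    then have "((\<lambda>t. \<phi> (x + t *\<^sub>R b)) has_real_derivative (b \<bullet> D x)) (at 0)"
      unfolding has_field_derivative_def by (rule has_derivative_eq_rhs) (simp add: fun_eq_iff mult.commute)
    then have "(\<lambda>t. (\<phi> (x + t *\<^sub>R b) - \<phi> x) / t) \<midarrow>0\<rightarrow> b \<bullet> D x"
      by (simp add: DERIV_def)
    moreover have "filterlim h (at 0) sequentially"
      unfolding h_def filterlim_at using LIMSEQ_inverse_real_of_nat by auto
    ultimately show ?thesis
      unfolding Q_def by (subst add.commute) (rule filterlim_compose)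
  qed
  define K' where "K' = {x + y | x y. x \<in> K \<and> y \<in> cball 0 (norm b)}"
  have K'c: "compact K'" unfolding K'_def by (rule compact_sums) (use K in auto)
  have KK': "K \<subseteq> K'" unfolding K'_def by force
  have dom: "norm (Q n x) \<le> M * norm b * indicator K' x" for n x
  proof (cases "x \<in> K'")
    case True
    have "norm (\<phi> (h n *\<^sub>R b + x) - \<phi> x) \<le> M * norm (h n *\<^sub>R b + x - x)"
      by (rule GDERIV_bounded_imp_Lipschitz[OF D M])
    then show ?thesis using True h[of n] by (auto simp: Q_def field_simps)
  next
    case False
    have "h n *\<^sub>R b + x \<notin> K"
    proof
      assume "h n *\<^sub>R b + x \<in> K"
      moreover have "- (h n *\<^sub>R b) \<in> cball 0 (norm b)" using h[of n] by (auto simp: mult_left_le_one_le)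
      moreover have "x = (h n *\<^sub>R b + x) + - (h n *\<^sub>R b)" by simp
      ultimately show False using False unfolding K'_def by blast
    qed
    then show ?thesis using False KK' K(2) by (auto simp: Q_def)
  qed
  have w: "integrable lborel (\<lambda>x. M * norm b * indicator K' x :: real)"
    using K'c emeasure_bounded_finite[of K'] by (auto simp: compact_imp_bounded compact_imp_closed)
  have meas: "Q n \<in> borel_measurable lborel" for n unfolding Q_def[abs_def] by measurable
  have meas': "(\<lambda>x. b \<bullet> D x) \<in> borel_measurable lborel"
    using lim meas by (rule borel_measurable_LIMSEQ_metric[rotated])
  note dct = meas' meas w AE_I2[OF lim] AE_I2[OF dom]
  show "integrable lborel (\<lambda>x. b \<bullet> D x)"
    using dct by (rule integrable_dominated_convergence)
  have "(\<lambda>n. LINT x|lborel. Q n x) \<longlonglongrightarrow> (LINT x|lborel. b \<bullet> D x)"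
    using dct by (rule integral_dominated_convergence)
  then show "(LINT x|lborel. b \<bullet> D x) = 0"
    unfolding Q0 by (simp add: LIMSEQ_const_iff)
qed

section \<open>The divergence of power vector fields\<close>

lemma GDERIV_norm_powr:
  fixes y :: "'a::euclidean_space"
  assumes "y \<noteq> x0"
  shows "GDERIV (\<lambda>x. norm (x - x0) powr e) y :> (e * norm (y - x0) powr (e - 2)) *\<^sub>R (y - x0)"
proof -
  have n: "norm (y - x0) > 0" using assms by simp
  have 1: "DERIV (\<lambda>t. t powr e) (norm (y - x0)) :> e * norm (y - x0) powr (e - 1)"
    using n by (auto intro!: derivative_eq_intros)
  have 2: "GDERIV (\<lambda>x. norm (x - x0)) y :> sgn (y - x0)"
    unfolding gderiv_def using assms
    by (intro has_derivative_compose[where f="\<lambda>x. x - x0" and g=norm and g'="\<lambda>h. h \<bullet> sgn (y - x0)"])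
       (auto intro!: derivative_eq_intros has_derivative_norm)
  have "norm (y - x0) powr (e - 1) = norm (y - x0) powr (e - 2) * norm (y - x0)"
    using n by (simp add: powr_diff power2_eq_square)
  then show ?thesis
    using GDERIV_DERIV_compose[OF 2 1] n
    by (simp add: sgn_div_norm mult.assoc)
qed

text \<open>This covers the centre of a power function, where the chain rule for the norm is not available.\<close>

lemma GDERIV_at_order_gt_1:
  fixes f :: "'a::euclidean_space \<Rightarrow> real"
  assumes "1 < t" "\<And>x. \<bar>f x\<bar> \<le> C * norm (x - x0) powr t"
  shows "GDERIV f x0 :> 0"
proof -
  have f0: "f x0 = 0" using assms(2)[of x0] by simp
  have "((\<lambda>x. norm (x - x0) powr (t - 1)) \<longlongrightarrow> norm (x0 - x0) powr (t - 1)) (at x0)"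
    using assms(1) by (intro tendsto_intros) auto
  then have "((\<lambda>x. C * norm (x - x0) powr (t - 1)) \<longlongrightarrow> 0) (at x0)"
    by (intro tendsto_mult_right_zero) simp
  moreover have "\<forall>\<^sub>F x in at x0. norm (f x / norm (x - x0)) \<le> C * norm (x - x0) powr (t - 1)"
  proof (rule eventually_mono[OF eventually_neq_at_within[of x0]])
    fix x assume "x \<noteq> x0"
    then show "norm (f x / norm (x - x0)) \<le> C * norm (x - x0) powr (t - 1)"
      using assms(2)[of x] by (simp add: powr_diff divide_right_mono)
  qed
  ultimately have "((\<lambda>x. f x / norm (x - x0)) \<longlongrightarrow> 0) (at x0)"
    by (rule Lim_null_comparison[rotated])
  then show ?thesis
    unfolding gderiv_def has_derivative_at_within by (simp add: f0 divide_inverse mult.commute)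
qed

text \<open>Integration by parts against the field \<open>|y|\<^sup>e y\<close>, \<open>y = x - x0\<close>, whose divergence is
  \<open>(N + e) |y|\<^sup>e\<close>. For \<open>e > 0\<close> the field is differentiable also at the centre;
  otherwise the centre has to lie outside the support.\<close>

lemma integral_power_field:
  fixes \<phi> :: "'a::euclidean_space \<Rightarrow> real"
  assumes D: "\<And>x. GDERIV \<phi> x :> D x" and Dc: "continuous_on UNIV D"
    and K: "compact K" "\<And>x. x \<notin> K \<Longrightarrow> \<phi> x = 0"
    and e: "x0 \<notin> K \<or> 0 < e"
  shows "integrable lborel (\<lambda>x. (real DIM('a) + e) * norm (x - x0) powr e * \<phi> x)"
    and "(LINT x|lborel. (norm (x - x0) powr e *\<^sub>R (x - x0)) \<bullet> D x)
         = - (LINT x|lborel. (real DIM('a) + e) * norm (x - x0) powr e * \<phi> x)"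
proof -
  define r where "r x = norm (x - x0)" for x
  have contphi: "continuous_on UNIV \<phi>"
    using D GDERIV_isCont continuous_at_imp_continuous_on by blast
  have D0: "D x = 0" if "x \<notin> K" for x
    using GDERIV_outside_support[OF D compact_imp_closed[OF K(1)] K(2) that] .
  have rc: "continuous_on K (\<lambda>x. r x powr e)"
    unfolding r_def using e
    by (intro continuous_on_powr' continuous_intros) auto
  have phib: "bounded (\<phi> ` K)" "bounded (D ` K)" "bounded ((\<lambda>x. r x powr e) ` K)" "bounded (r ` K)"
    unfolding r_def using r_def rc
    by (auto intro!: compact_imp_bounded compact_continuous_image K continuous_intros
        continuous_on_subset[OF contphi] continuous_on_subset[OF Dc] simp: r_def)
  obtain A1 where A1: "\<And>x. x \<in> K \<Longrightarrow> \<bar>\<phi> x\<bar> \<le> A1" using phib(1) by (auto simp: bounded_iff)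
  obtain A2 where A2: "\<And>x. x \<in> K \<Longrightarrow> norm (D x) \<le> A2" using phib(2) by (auto simp: bounded_iff)
  obtain A3 where A3: "\<And>x. x \<in> K \<Longrightarrow> r x powr e \<le> A3" using phib(3) by (auto simp: bounded_iff)
  obtain A4 where A4: "\<And>x. x \<in> K \<Longrightarrow> r x \<le> A4" using phib(4) unfolding bounded_iff by (metis abs_le_D1 imageI real_norm_def)
  \<comment> \<open>The gradient of \<open>|y|\<^sup>e (y \<bullet> b) \<phi>\<close>, \<open>y = x - x0\<close>. The formula is correct at \<open>x0\<close> as well,
    because \<open>0 powr e = 0\<close> makes it vanish there.\<close>
  define E where "E b x = \<phi> x *\<^sub>R (r x powr e *\<^sub>R b + (e * r x powr (e-2) * ((x - x0) \<bullet> b)) *\<^sub>R (x - x0))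
       + (r x powr e * ((x - x0) \<bullet> b)) *\<^sub>R D x" for b x
  have E: "GDERIV (\<lambda>x. r x powr e * ((x - x0) \<bullet> b) * \<phi> x) x :> E b x" for b x
  proof (cases "x = x0")
    case False
    have l: "GDERIV (\<lambda>x. (x - x0) \<bullet> b) x :> b"
      unfolding gderiv_def by (auto intro!: derivative_eq_intros simp: inner_commute)
    show ?thesis
      using GDERIV_mult[OF GDERIV_mult[OF GDERIV_norm_powr[OF False, of e] l] D]
      unfolding r_def by (rule GDERIV_subst) (simp add: E_def r_def algebra_simps)
  next
    case True
    then have E0: "E b x = 0" by (simp add: E_def r_def)
    show ?thesis
    proof (cases "x0 \<in> K")
      case False
      have "GDERIV (\<lambda>x. 0) x :> 0" by (rule GDERIV_const)
      then show ?thesis unfolding E0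
        by (rule GDERIV_transform_open[where S="-K"])
           (use K(2) False True compact_imp_closed[OF K(1)] in auto)
    next
      case True2: True
      then have "e > 0" using e by auto
      moreover have "\<bar>r x powr e * ((x - x0) \<bullet> b) * \<phi> x\<bar> \<le> (norm b * A1) * norm (x - x0) powr (1 + e)" for x
      proof (cases "x \<in> K")
        case True
        have "\<bar>(x - x0) \<bullet> b\<bar> \<le> r x * norm b" unfolding r_def by (rule Cauchy_Schwarz_ineq2)
        then have "\<bar>r x powr e * ((x - x0) \<bullet> b) * \<phi> x\<bar> \<le> r x powr e * (r x * norm b) * A1"
          unfolding abs_mult using A1[OF True] by (intro mult_mono) (auto simp: r_def)
        also have "\<dots> = (norm b * A1) * norm (x - x0) powr (1 + e)"
          by (cases "x = x0") (auto simp: r_def powr_add)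
        finally show ?thesis .
      next
        case False
        have "0 \<le> A1" using A1[OF True2] by linarith
        then show ?thesis using K(2)[OF False] by simp
      qed
      ultimately have "GDERIV (\<lambda>x. r x powr e * ((x - x0) \<bullet> b) * \<phi> x) x0 :> 0"
        by (intro GDERIV_at_order_gt_1[where t="1+e"]) auto
      then show ?thesis unfolding E0 using True by simp
    qed
  qed
  have Eb: "norm (E b x) \<le> \<bar>A1\<bar> * (\<bar>A3\<bar> + \<bar>e\<bar> * \<bar>A3\<bar>) + \<bar>A3\<bar> * \<bar>A4\<bar> * \<bar>A2\<bar>" if b: "norm b = 1" for b x
  proof (cases "x \<in> K")
    case True
    have ib: "\<bar>(x - x0) \<bullet> b\<bar> \<le> r x"
      using Cauchy_Schwarz_ineq2[of "x - x0" b] b by (simp add: r_def)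
    have "norm ((e * r x powr (e-2) * ((x - x0) \<bullet> b)) *\<^sub>R (x - x0)) = \<bar>e\<bar> * (r x powr (e-2) * \<bar>(x - x0) \<bullet> b\<bar> * r x)"
      by (simp add: abs_mult r_def)
    also have "\<dots> \<le> \<bar>e\<bar> * (r x powr (e-2) * r x * r x)"
      using ib by (intro mult_left_mono mult_right_mono) (auto simp: r_def)
    also have "r x powr (e-2) * r x * r x = r x powr e"
      by (cases "x = x0") (auto simp: r_def powr_diff power2_eq_square)
    finally have t2: "norm ((e * r x powr (e-2) * ((x - x0) \<bullet> b)) *\<^sub>R (x - x0)) \<le> \<bar>e\<bar> * \<bar>A3\<bar>"
      using A3[OF True] by (meson abs_ge_self abs_ge_zero mult_left_mono order_trans)
    have t1: "norm (r x powr e *\<^sub>R b) \<le> \<bar>A3\<bar>" using A3[OF True] b by simp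
    have "norm (E b x) \<le> norm (\<phi> x *\<^sub>R (r x powr e *\<^sub>R b + (e * r x powr (e-2) * ((x - x0) \<bullet> b)) *\<^sub>R (x - x0)))
        + norm ((r x powr e * ((x - x0) \<bullet> b)) *\<^sub>R D x)"
      unfolding E_def by (rule norm_triangle_ineq)
    also have "\<dots> \<le> \<bar>A1\<bar> * (\<bar>A3\<bar> + \<bar>e\<bar> * \<bar>A3\<bar>) + \<bar>A3\<bar> * \<bar>A4\<bar> * \<bar>A2\<bar>"
    proof (intro add_mono)
      have "norm (r x powr e *\<^sub>R b + (e * r x powr (e-2) * ((x - x0) \<bullet> b)) *\<^sub>R (x - x0)) \<le> \<bar>A3\<bar> + \<bar>e\<bar> * \<bar>A3\<bar>"
        by (rule norm_triangle_le[OF add_mono[OF t1 t2]])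
      moreover have "\<bar>\<phi> x\<bar> \<le> \<bar>A1\<bar>" using A1[OF True] by linarith
      ultimately show "norm (\<phi> x *\<^sub>R (r x powr e *\<^sub>R b + (e * r x powr (e-2) * ((x - x0) \<bullet> b)) *\<^sub>R (x - x0))) \<le> \<bar>A1\<bar> * (\<bar>A3\<bar> + \<bar>e\<bar> * \<bar>A3\<bar>)"
        unfolding norm_scaleR by (intro mult_mono) auto
      have "\<bar>r x powr e\<bar> \<le> \<bar>A3\<bar>" "\<bar>(x - x0) \<bullet> b\<bar> \<le> \<bar>A4\<bar>" "norm (D x) \<le> \<bar>A2\<bar>"
        using A2[OF True] A3[OF True] A4[OF True] ib by auto
      then show "norm ((r x powr e * ((x - x0) \<bullet> b)) *\<^sub>R D x) \<le> \<bar>A3\<bar> * \<bar>A4\<bar> * \<bar>A2\<bar>"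
        unfolding norm_scaleR abs_mult by (intro mult_mono) auto
    qed
    finally show ?thesis .
  next
    case False
    then show ?thesis by (simp add: E_def K(2) D0)
  qed
  note E0 = integral_GDERIV_eq_0[OF E Eb K(1)]
  have ident: "(\<Sum>b\<in>Basis. b \<bullet> E b x) = (real DIM('a) + e) * r x powr e * \<phi> x + (r x powr e *\<^sub>R (x - x0)) \<bullet> D x" for x
  proof -
    define w where "w = x - x0"
    have i1: "(\<Sum>b\<in>Basis. (w \<bullet> b) * (b \<bullet> v)) = w \<bullet> v" for v
      by (subst euclidean_inner) (simp add: inner_commute)
    have i2: "r x powr (e-2) * (w \<bullet> w) = r x powr e"
      by (cases "w = 0") (auto simp: r_def powr_diff dot_square_norm w_def)
    have "b \<bullet> E b x = \<phi> x * r x powr e + \<phi> x * e * r x powr (e-2) * ((w \<bullet> b) * (b \<bullet> w))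
        + r x powr e * ((w \<bullet> b) * (b \<bullet> D x))" if "b \<in> Basis" for b
      using that unfolding E_def w_def[symmetric] by (simp add: inner_add_right) (simp add: algebra_simps)
    then have "(\<Sum>b\<in>Basis. b \<bullet> E b x) = (\<Sum>b\<in>(Basis::'a set). \<phi> x * r x powr e + \<phi> x * e * r x powr (e-2) * ((w \<bullet> b) * (b \<bullet> w))
        + r x powr e * ((w \<bullet> b) * (b \<bullet> D x)))"
      by (rule sum.cong[OF refl])
    also have "\<dots> = real DIM('a) * (\<phi> x * r x powr e) + \<phi> x * e * (r x powr (e-2) * (w \<bullet> w)) + r x powr e * (w \<bullet> D x)"
      unfolding sum.distrib sum_distrib_left[symmetric] i1 by simp
    finally show ?thesis unfolding i2 w_def[symmetric] by (simp add: algebra_simps)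
  qed
  have z: "\<phi> x = 0 \<or> x \<in> K" for x using K(2) by auto
  have intE: "integrable lborel (\<lambda>x. b \<bullet> E b x)" "(LINT x|lborel. b \<bullet> E b x) = 0" if "b \<in> Basis" for b
    using E0[of b b] K(2) that by auto
  have "(LINT x|lborel. (\<Sum>b\<in>Basis. b \<bullet> E b x)) = 0"
    by (subst Bochner_Integration.integral_sum) (auto simp: intE)
  then have sum0: "(LINT x|lborel. (real DIM('a) + e) * r x powr e * \<phi> x + (r x powr e *\<^sub>R (x - x0)) \<bullet> D x) = 0"
    unfolding ident .
  have I1: "integrable lborel (\<lambda>x. (real DIM('a) + e) * r x powr e * \<phi> x)"
  proof -
    have "integrable lborel (\<lambda>x. indicator K x *\<^sub>R ((real DIM('a) + e) * r x powr e * \<phi> x))"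
      by (intro borel_integrable_compact K continuous_intros rc continuous_on_subset[OF contphi]) auto
    also have "(\<lambda>x. indicator K x *\<^sub>R ((real DIM('a) + e) * r x powr e * \<phi> x)) = (\<lambda>x. (real DIM('a) + e) * r x powr e * \<phi> x)"
      using K(2) by (auto simp: fun_eq_iff indicator_def)
    finally show ?thesis .
  qed
  have I2: "integrable lborel (\<lambda>x. (r x powr e *\<^sub>R (x - x0)) \<bullet> D x)"
  proof -
    have "integrable lborel (\<lambda>x. indicator K x *\<^sub>R ((r x powr e *\<^sub>R (x - x0)) \<bullet> D x))"
      by (intro borel_integrable_compact K continuous_intros rc continuous_on_subset[OF Dc]) auto
    also have "(\<lambda>x. indicator K x *\<^sub>R ((r x powr e *\<^sub>R (x - x0)) \<bullet> D x)) = (\<lambda>x. (r x powr e *\<^sub>R (x - x0)) \<bullet> D x)"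
      using D0 by (auto simp: fun_eq_iff indicator_def)
    finally show ?thesis .
  qed
  show "integrable lborel (\<lambda>x. (real DIM('a) + e) * norm (x - x0) powr e * \<phi> x)"
    using I1 by (simp add: r_def)
  show "(LINT x|lborel. (norm (x - x0) powr e *\<^sub>R (x - x0)) \<bullet> D x)
         = - (LINT x|lborel. (real DIM('a) + e) * norm (x - x0) powr e * \<phi> x)"
    using sum0 unfolding Bochner_Integration.integral_add[OF I1 I2] by (simp add: r_def)
qed

section \<open>Mollification\<close>

text \<open>The square of the positive part is continuously differentiable, unlike the positive part itself.
  It serves twice: it cuts off the mollification kernel, and it turns the excess of a barrier over a
  supersolution into a test function.\<close>

definition possq :: "real \<Rightarrow> real" where "possq t = (max 0 t)\<^sup>2"

lemma possq_nonneg: "0 \<le> possq t" by (simp add: possq_def)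

lemma possq_eq_0: "t \<le> 0 \<Longrightarrow> possq t = 0" by (simp add: possq_def)

lemma continuous_on_possq [continuous_intros]: "continuous_on S f \<Longrightarrow> continuous_on S (\<lambda>x. possq (f x))"
  unfolding possq_def by (intro continuous_intros)

lemma DERIV_possq: "DERIV possq t :> 2 * max 0 t"
proof -
  consider "t > 0" | "t < 0" | "t = 0" by linarith
  then show ?thesis
  proof cases
    case 1
    have "DERIV (\<lambda>t. t\<^sup>2) t :> 2 * max 0 t"
      using 1 by (auto intro!: derivative_eq_intros)
    then show ?thesis
      by (rule has_field_derivative_transform_within_open[where S="{0<..}"]) (use 1 in \<open>auto simp: possq_def\<close>)
  next
    case 2
    have "DERIV (\<lambda>t. 0) t :> 2 * max 0 t" using 2 by simp
    then show ?thesis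
      by (rule has_field_derivative_transform_within_open[where S="{..<0}"]) (use 2 in \<open>auto simp: possq_def\<close>)
  next
    case 3
    have "(\<lambda>h. max 0 h * (max 0 h / h)) \<midarrow>0\<rightarrow> (0::real)"
    proof (rule Lim_null_comparison[where g="\<lambda>h. \<bar>h\<bar>"])
      show "\<forall>\<^sub>F h in at (0::real). norm (max 0 h * (max 0 h / h)) \<le> \<bar>h\<bar>"
        by (rule always_eventually) (auto simp: max_def)
      show "(abs \<longlongrightarrow> 0) (at (0::real))" by (rule tendsto_eq_intros refl | simp)+
    qed
    then show ?thesis unfolding 3 DERIV_def by (simp add: possq_def power2_eq_square)
  qed
qed

text \<open>The unnormalised kernel \<open>((d\<^sup>2 - |z|\<^sup>2)\<^sup>+)\<^sup>2\<close>. Test functions need only one continuous derivative,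
  so a polynomial profile is enough.\<close>

definition bump :: "real \<Rightarrow> 'a::euclidean_space \<Rightarrow> real" where
  "bump d z = possq (d\<^sup>2 - z \<bullet> z)"

definition bump_mass :: "real \<Rightarrow> 'a::euclidean_space itself \<Rightarrow> real" where
  "bump_mass d T = (LINT z::'a|lborel. bump d z)"

definition unit_bump :: "real \<Rightarrow> 'a::euclidean_space \<Rightarrow> real" where
  "unit_bump d z = bump d z / bump_mass d TYPE('a)"

definition unit_bump_grad :: "real \<Rightarrow> 'a::euclidean_space \<Rightarrow> 'a" where
  "unit_bump_grad d z = - (4 * max 0 (d\<^sup>2 - z \<bullet> z) / bump_mass d TYPE('a)) *\<^sub>R z"

lemma bump_nonneg: "0 \<le> bump d z" by (simp add: bump_def possq_nonneg)

lemma bump_eq_0: "0 < d \<Longrightarrow> d \<le> norm z \<Longrightarrow> bump d z = 0"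
  unfolding bump_def using power_mono[of d "norm z" 2] by (intro possq_eq_0) (simp add: power2_norm_eq_inner)

lemma continuous_on_bump: "continuous_on S (bump d)"
  unfolding bump_def[abs_def] by (intro continuous_intros)

lemma integrable_bump: "0 < d \<Longrightarrow> integrable lborel (bump d :: 'a::euclidean_space \<Rightarrow> real)"
  by (rule integrable_continuous_compact_support[where K="cball 0 d"])
     (auto simp: bump_eq_0 continuous_on_bump)

lemma bump_mass_pos:
  assumes "0 < d" shows "0 < bump_mass d TYPE('a::euclidean_space)"
proof -
  let ?c = "(3/4 * d\<^sup>2)\<^sup>2"
  have "?c * measure lborel (ball (0::'a) (d/2)) = (LINT z::'a|lborel. ?c * indicator (ball 0 (d/2)) z)"
    by simp
  also have "\<dots> \<le> bump_mass d TYPE('a)"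
    unfolding bump_mass_def
  proof (rule integral_mono)
    show "integrable lborel (\<lambda>z::'a. ?c * indicator (ball 0 (d/2)) z)"
      using emeasure_bounded_finite[of "ball (0::'a) (d/2)"] by auto
    show "integrable lborel (bump d :: 'a \<Rightarrow> real)" using assms by (rule integrable_bump)
    fix z :: 'a
    show "?c * indicator (ball 0 (d/2)) z \<le> bump d z"
    proof (cases "z \<in> ball 0 (d/2)")
      case True
      then have "(norm z)\<^sup>2 \<le> (d/2)\<^sup>2" by (intro power_mono) auto
      then have "3/4 * d\<^sup>2 \<le> d\<^sup>2 - z \<bullet> z" by (simp add: power2_norm_eq_inner power_divide)
      then have "?c \<le> bump d z" unfolding bump_def possq_def by (intro power_mono) (auto simp: le_max_iff_disj)
      then show ?thesis using True by simp
    qed (simp add: bump_nonneg)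
  qed
  finally have "?c * measure lborel (ball (0::'a) (d/2)) \<le> bump_mass d TYPE('a)" .
  moreover have "0 < ?c * measure lborel (ball (0::'a) (d/2))"
    using content_ball_pos[of "d/2" "0::'a"] assms by (intro mult_pos_pos) auto
  ultimately show ?thesis by linarith
qed

context
  fixes d :: real assumes d: "0 < d"
begin

lemma unit_bump_nonneg: "0 \<le> unit_bump d (z::'a::euclidean_space)"
  unfolding unit_bump_def using bump_mass_pos[OF d, where 'a='a] by (simp add: bump_nonneg)

lemma unit_bump_eq_0: "d \<le> norm z \<Longrightarrow> unit_bump d z = 0"
  using d by (simp add: unit_bump_def bump_eq_0)

lemma unit_bump_grad_eq_0: "d \<le> norm z \<Longrightarrow> unit_bump_grad d z = 0"
  unfolding unit_bump_grad_def using d power_mono[of d "norm z" 2] by (simp add: power2_norm_eq_inner)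

lemma continuous_on_unit_bump: "continuous_on S (unit_bump d :: 'a::euclidean_space \<Rightarrow> real)"
  unfolding unit_bump_def[abs_def] using bump_mass_pos[OF d, where 'a='a] by (intro continuous_intros continuous_on_bump) auto

lemma continuous_on_unit_bump_grad: "continuous_on S (unit_bump_grad d :: 'a::euclidean_space \<Rightarrow> 'a)"
  unfolding unit_bump_grad_def[abs_def] using bump_mass_pos[OF d, where 'a='a] by (intro continuous_intros) auto

lemma unit_bump_measurable [measurable]: "(unit_bump d :: 'a::euclidean_space \<Rightarrow> real) \<in> borel_measurable borel"
  by (intro borel_measurable_continuous_onI continuous_on_unit_bump)

lemma GDERIV_unit_bump: "GDERIV (unit_bump d) z :> unit_bump_grad d (z::'a::euclidean_space)"
proof -
  have "GDERIV (\<lambda>z. d\<^sup>2 - z \<bullet> z) z :> - (2 *\<^sub>R z)"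
    unfolding gderiv_def by (auto intro!: derivative_eq_intros simp: inner_commute)
  from GDERIV_DERIV_compose[OF this DERIV_possq]
  have "GDERIV (bump d) z :> (2 * max 0 (d\<^sup>2 - z \<bullet> z)) *\<^sub>R - (2 *\<^sub>R z)"
    by (simp add: bump_def[abs_def])
  then have "GDERIV (\<lambda>z. bump d z / bump_mass d TYPE('a)) z :> (1 / bump_mass d TYPE('a)) *\<^sub>R (2 * max 0 (d\<^sup>2 - z \<bullet> z)) *\<^sub>R - (2 *\<^sub>R z)"
    by (rule GDERIV_DERIV_compose[where g="\<lambda>t. t / bump_mass d TYPE('a)"]) (rule DERIV_cdivide[OF DERIV_ident])
  then show ?thesis unfolding unit_bump_def[abs_def]
    by (rule GDERIV_subst) (simp add: unit_bump_grad_def)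
qed

lemma unit_bump_minus: "unit_bump d ((x::'a::euclidean_space) - y) = unit_bump d (y - x)"
  by (simp add: unit_bump_def bump_def inner_diff_left inner_diff_right inner_commute algebra_simps)

lemma nn_integral_unit_bump: "(\<integral>\<^sup>+y. ennreal (unit_bump d (y - (x::'a::euclidean_space))) \<partial>lborel) = 1"
proof -
  have "(\<integral>\<^sup>+y. ennreal (unit_bump d (y - x)) \<partial>lborel) = (\<integral>\<^sup>+y. ennreal (unit_bump d (y - x)) \<partial>distr lborel borel ((+) x))"
    by (simp only: lborel_distr_plus)
  also have "\<dots> = (\<integral>\<^sup>+y. ennreal (unit_bump d (y::'a)) \<partial>lborel)"
    by (subst nn_integral_distr) auto
  also have "\<dots> = ennreal (LINT y::'a|lborel. unit_bump d y)"
  proof (rule nn_integral_eq_integral)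
    show "integrable lborel (unit_bump d :: 'a \<Rightarrow> real)"
      unfolding unit_bump_def[abs_def] by (rule integrable_divide[OF integrable_bump[OF d]])
  qed (auto simp: unit_bump_nonneg)
  also have "(LINT y::'a|lborel. unit_bump d y) = 1"
    using bump_mass_pos[OF d, where 'a='a] unfolding unit_bump_def by (simp add: bump_mass_def)
  finally show ?thesis by simp
qed

lemma nn_integral_unit_bump': "(\<integral>\<^sup>+y. ennreal (unit_bump d ((x::'a::euclidean_space) - y)) \<partial>lborel) = 1"
  using nn_integral_unit_bump[of x] by (simp add: unit_bump_minus)

lemma unit_bump_integral: "integrable lborel (\<lambda>y. unit_bump d ((x::'a::euclidean_space) - y))" "(LINT y|lborel. unit_bump d (x - y)) = 1"
proof -
  show i: "integrable lborel (\<lambda>y. unit_bump d (x - y))"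
    by (rule integrableI_bounded) (auto simp: nn_integral_unit_bump' unit_bump_nonneg)
  have "ennreal (LINT y|lborel. unit_bump d (x - y)) = 1"
    using nn_integral_eq_integral[OF i] unit_bump_nonneg nn_integral_unit_bump'[of x] by auto
  then show "(LINT y|lborel. unit_bump d (x - y)) = 1" by simp
qed

end

definition mollify :: "real \<Rightarrow> ('a::euclidean_space \<Rightarrow> 'b::euclidean_space) \<Rightarrow> 'a \<Rightarrow> 'b" where
  "mollify d h x = (LINT y|lborel. unit_bump d (x - y) *\<^sub>R h y)"

lemma integrable_unit_bump_scaleR:
  fixes h :: "'a::euclidean_space \<Rightarrow> 'b::euclidean_space"
  assumes "0 < d" "continuous_on UNIV h"
  shows "integrable lborel (\<lambda>y. unit_bump d (x - y) *\<^sub>R h y)"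
proof (rule integrable_continuous_compact_support[where K="cball x d"])
  show "continuous_on UNIV (\<lambda>y. unit_bump d (x - y) *\<^sub>R h y)"
    by (intro continuous_intros assms continuous_on_compose2[OF continuous_on_unit_bump[OF assms(1), of UNIV]]) auto
qed (use assms(1) in \<open>auto simp: unit_bump_eq_0 dist_norm\<close>)

text \<open>A mollification is an average over the ball of radius \<open>d\<close>.\<close>

lemma mollify_close:
  fixes h :: "'a::euclidean_space \<Rightarrow> 'b::euclidean_space"
  assumes d: "0 < d" and h: "continuous_on UNIV h" and e: "\<And>y. norm (y - x) \<le> d \<Longrightarrow> norm (h y - h x) \<le> e"
  shows "norm (mollify d h x - h x) \<le> e"
proof -
  have i1: "integrable lborel (\<lambda>y. unit_bump d (x - y) *\<^sub>R h y)"
    using integrable_unit_bump_scaleR[OF d h] .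
  have i2: "integrable lborel (\<lambda>y. unit_bump d (x - y) *\<^sub>R h x)"
    using unit_bump_integral(1)[OF d, of x] by (intro integrable_scaleR_left)
  have "mollify d h x - h x = (LINT y|lborel. unit_bump d (x - y) *\<^sub>R h y - unit_bump d (x - y) *\<^sub>R h x)"
    unfolding Bochner_Integration.integral_diff[OF i1 i2] using unit_bump_integral[OF d, of x] by (simp add: mollify_def)
  also have "norm \<dots> \<le> (LINT y|lborel. unit_bump d (x - y) * e)"
  proof (rule Bochner_Integration.integral_norm_bound_integral)
    show "integrable lborel (\<lambda>y. unit_bump d (x - y) *\<^sub>R h y - unit_bump d (x - y) *\<^sub>R h x)"
      using i1 i2 by auto
    show "integrable lborel (\<lambda>y. unit_bump d (x - y) * e)"
      using unit_bump_integral(1)[OF d] by auto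
    show "norm (unit_bump d (x - y) *\<^sub>R h y - unit_bump d (x - y) *\<^sub>R h x) \<le> unit_bump d (x - y) * e" for y
    proof (cases "norm (y - x) \<le> d")
      case True
      have "norm (unit_bump d (x - y) *\<^sub>R h y - unit_bump d (x - y) *\<^sub>R h x) = unit_bump d (x - y) * norm (h y - h x)"
        unfolding scaleR_diff_right[symmetric] using unit_bump_nonneg[OF d, of "x - y"] by simp
      then show ?thesis using mult_left_mono[OF e[OF True] unit_bump_nonneg[OF d, of "x - y"]] by simp
    next
      case False
      then show ?thesis using unit_bump_eq_0[OF d, of "x - y"] by (simp add: norm_minus_commute)
    qed
  qed
  also have "\<dots> = e" using unit_bump_integral[OF d, of x] by simp
  finally show ?thesis .
qed

lemma mollify_uniform_limit:
  fixes h :: "'a::euclidean_space \<Rightarrow> 'b::euclidean_space"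
  assumes h: "continuous_on UNIV h" and K: "compact K" and e: "0 < e"
  shows "\<exists>d0>0. \<forall>d. 0 < d \<and> d < d0 \<longrightarrow> (\<forall>x\<in>K. norm (mollify d h x - h x) \<le> e)"
proof -
  define L where "L = {x + y | x y. x \<in> K \<and> y \<in> cball 0 1}"
  have "compact L" unfolding L_def by (rule compact_sums) (use K in auto)
  then have "uniformly_continuous_on L h"
    using compact_uniformly_continuous continuous_on_subset[OF h] by blast
  then obtain d0 where d0: "d0 > 0" "\<And>x y. x \<in> L \<Longrightarrow> y \<in> L \<Longrightarrow> dist y x < d0 \<Longrightarrow> dist (h y) (h x) < e"
    using e unfolding uniformly_continuous_on_def by blast
  show ?thesis
  proof (intro exI[of _ "min d0 1"] conjI allI impI ballI)
    fix d x assume d: "0 < d \<and> d < min d0 1" and x: "x \<in> K"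
    show "norm (mollify d h x - h x) \<le> e"
    proof (rule mollify_close[OF _ h])
      fix y assume y: "norm (y - x) \<le> d"
      have "x \<in> L" unfolding L_def using x by force
      moreover have "y \<in> L" unfolding L_def using x y d by (intro CollectI exI[of _ x] exI[of _ "y - x"]) auto
      ultimately show "norm (h y - h x) \<le> e" using d0(2)[of x y] y d by (simp add: dist_norm)
    qed (use d in auto)
  qed (use d0 in auto)
qed

text \<open>Differentiation under the integral sign moves the gradient to the kernel. Hence the mollification
  of a merely continuous function is continuously differentiable and may enter a test function.\<close>

lemma GDERIV_mollify:
  fixes h :: "'a::euclidean_space \<Rightarrow> real"
  assumes d: "0 < d" and h: "continuous_on UNIV h"
  shows "GDERIV (mollify d h) x :> (LINT y|lborel. h y *\<^sub>R unit_bump_grad d (x - y))"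
    and "continuous_on UNIV (\<lambda>x. LINT y|lborel. h y *\<^sub>R unit_bump_grad d (x - y))"
proof -
  have *: "GDERIV (mollify d h) x0 :> (LINT y|lborel. h y *\<^sub>R unit_bump_grad d (x0 - y)) \<and>
      isCont (\<lambda>x. LINT y|lborel. h y *\<^sub>R unit_bump_grad d (x - y)) x0" for x0
  proof -
    have "bounded (cball x0 (1 + d))" by simp
    then obtain a b where ab: "cball x0 (1 + d) \<subseteq> cbox a b"
      using bounded_subset_cbox_symmetric by blast
    define U where "U = ball x0 1"
    have out: "d \<le> norm (x - y)" if "x \<in> U" "y \<notin> cbox a b" for x y
    proof -
      have "1 + d < dist x0 y" using that ab by (force simp: subset_iff)
      moreover have "dist x0 x < 1" using that by (simp add: U_def)
      ultimately show ?thesis using dist_triangle[of x0 y x] by (simp add: dist_norm)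
    qed
    have cint: "(LINT y|lborel. F y) = integral (cbox a b) F"
      if "continuous_on UNIV F" "\<And>y. y \<notin> cbox a b \<Longrightarrow> F y = 0" for F :: "'a \<Rightarrow> 'b::euclidean_space"
    proof -
      have "integrable lborel F"
        by (rule integrable_continuous_compact_support[OF that(1) compact_cbox that(2)])
      then have "(LINT y|lborel. F y) = integral UNIV F" by (simp add: integral_lborel)
      also have "\<dots> = integral (cbox a b) F"
        by (rule integral_spike_set)
           (rule negligible_subset[of "{}"], use that(2) in auto)+
      finally show ?thesis .
    qed
    have c1: "continuous_on UNIV (\<lambda>y. unit_bump d (x - y) *\<^sub>R h y)" for x
      by (intro continuous_intros h continuous_on_compose2[OF continuous_on_unit_bump[OF d, of UNIV]]) auto
    have c2: "continuous_on UNIV (\<lambda>y. h y *\<^sub>R unit_bump_grad d (x - y))" for x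
      by (intro continuous_intros h continuous_on_compose2[OF continuous_on_unit_bump_grad[OF d, of UNIV]]) auto
    have e1: "mollify d h x = integral (cbox a b) (\<lambda>y. unit_bump d (x - y) *\<^sub>R h y)" if "x \<in> U" for x
      unfolding mollify_def by (rule cint[OF c1]) (use out[OF that] unit_bump_eq_0[OF d] in auto)
    have e2: "(LINT y|lborel. h y *\<^sub>R unit_bump_grad d (x - y)) = integral (cbox a b) (\<lambda>y. h y *\<^sub>R unit_bump_grad d (x - y))" if "x \<in> U" for x
      by (rule cint[OF c2]) (use out[OF that] unit_bump_grad_eq_0[OF d] in auto)
    have cont2: "continuous_on (U \<times> cbox a b) (\<lambda>(x, y). h y *\<^sub>R unit_bump_grad d (x - y))"
      unfolding split_beta
      by (intro continuous_intros continuous_on_compose2[OF h] continuous_on_compose2[OF continuous_on_unit_bump_grad[OF d, of UNIV]]) auto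
    have x0U: "x0 \<in> U" "open U" "convex U" by (auto simp: U_def)
    let ?F = "\<lambda>x y. blinfun_inner_left (h y *\<^sub>R unit_bump_grad d (x - y))"
    have "((\<lambda>x. integral (cbox a b) (\<lambda>y. unit_bump d (x - y) *\<^sub>R h y)) has_derivative
        blinfun_apply (integral (cbox a b) (?F x0))) (at x0 within U)"
    proof (rule leibniz_rule)
      fix x y :: 'a
      have k: "GDERIV (unit_bump d) (x - y) :> unit_bump_grad d (x - y)" by (rule GDERIV_unit_bump[OF d])
      have "((\<lambda>x. unit_bump d (x - y) *\<^sub>R h y) has_derivative (\<lambda>v. (v \<bullet> unit_bump_grad d (x - y)) *\<^sub>R h y)) (at x)"
        using k[unfolded gderiv_def]
        by (intro has_derivative_scaleR_left has_derivative_compose[where f="\<lambda>x. x - y" and g="unit_bump d" and g'="\<lambda>v. v \<bullet> unit_bump_grad d (x - y)"])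
           (auto intro!: derivative_eq_intros)
      then show "((\<lambda>x. unit_bump d (x - y) *\<^sub>R h y) has_derivative blinfun_apply (?F x y)) (at x within U)"
        by (rule has_derivative_at_withinI[THEN has_derivative_eq_rhs]) (auto simp: fun_eq_iff mult.commute)
    next
      show "(\<lambda>y. unit_bump d (x - y) *\<^sub>R h y) integrable_on cbox a b" for x
        by (intro integrable_continuous continuous_on_subset[OF c1]) auto
      show "continuous_on (U \<times> cbox a b) (\<lambda>(x, y). ?F x y)"
        using bounded_linear.continuous_on[OF bounded_linear_blinfun_inner_left cont2] by (simp add: split_beta)
    qed (use x0U in auto)
    moreover have "blinfun_apply (integral (cbox a b) (?F x0)) = (\<lambda>v. v \<bullet> integral (cbox a b) (\<lambda>y. h y *\<^sub>R unit_bump_grad d (x0 - y)))"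
    proof -
      have i: "(\<lambda>y. h y *\<^sub>R unit_bump_grad d (x0 - y)) integrable_on cbox a b"
        by (intro integrable_continuous continuous_on_subset[OF c2]) auto
      have "integral (cbox a b) (?F x0) = blinfun_inner_left (integral (cbox a b) (\<lambda>y. h y *\<^sub>R unit_bump_grad d (x0 - y)))"
        using integral_linear[OF i bounded_linear_blinfun_inner_left] by (simp add: o_def)
      then show ?thesis by (simp add: fun_eq_iff)
    qed
    ultimately have "((\<lambda>x. integral (cbox a b) (\<lambda>y. unit_bump d (x - y) *\<^sub>R h y)) has_derivative
        (\<lambda>v. v \<bullet> (LINT y|lborel. h y *\<^sub>R unit_bump_grad d (x0 - y)))) (at x0)"
      by (simp only: at_within_open[OF x0U(1,2)] e2[OF x0U(1)])
    then have g: "GDERIV (mollify d h) x0 :> (LINT y|lborel. h y *\<^sub>R unit_bump_grad d (x0 - y))"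
      unfolding gderiv_def by (rule has_derivative_transform_within_open[OF _ x0U(2,1)]) (simp add: e1)
    have "continuous_on U (\<lambda>x. integral (cbox a b) (\<lambda>y. h y *\<^sub>R unit_bump_grad d (x - y)))"
      using integral_continuous_on_param[OF cont2] .
    then have "continuous_on U (\<lambda>x. LINT y|lborel. h y *\<^sub>R unit_bump_grad d (x - y))"
      by (rule continuous_on_eq) (simp add: e2)
    then have "isCont (\<lambda>x. LINT y|lborel. h y *\<^sub>R unit_bump_grad d (x - y)) x0"
      using x0U continuous_on_eq_continuous_at by blast
    with g show ?thesis by blast
  qed
  show "GDERIV (mollify d h) x :> (LINT y|lborel. h y *\<^sub>R unit_bump_grad d (x - y))" using * by blast
  show "continuous_on UNIV (\<lambda>x. LINT y|lborel. h y *\<^sub>R unit_bump_grad d (x - y))"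
    using * continuous_at_imp_continuous_on by blast
qed

section \<open>Convergence of mollifications in weighted norms\<close>

lemma powr_add_le:
  fixes a b p :: real
  assumes "0 \<le> a" "0 \<le> b" "0 \<le> p"
  shows "(a + b) powr p \<le> 2 powr p * (a powr p + b powr p)"
proof -
  have "(a + b) powr p \<le> (2 * max a b) powr p"
    using assms by (intro powr_mono2) auto
  also have "\<dots> = 2 powr p * max a b powr p" using assms by (simp add: powr_mult)
  also have "\<dots> \<le> 2 powr p * (a powr p + b powr p)"
    by (intro mult_left_mono) (auto simp: max_def)
  finally show ?thesis .
qed

text \<open>Young's inequality in a form without the conjugate exponent: either \<open>b \<le> t w\<close>, or \<open>w < b / t\<close>.\<close>

lemma weight_young:
  fixes w b t p :: real
  assumes "1 < p" "0 < t" "1 \<le> w" "0 \<le> b"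
  shows "w powr (p - 1) * b \<le> t * w powr p + t powr (1 - p) * b powr p"
proof (cases "b \<le> t * w")
  case True
  have "w powr (p - 1) * b \<le> w powr (p - 1) * (t * w)"
    using True by (intro mult_left_mono) auto
  also have "\<dots> = t * w powr p" using assms by (simp add: powr_diff)
  finally show ?thesis by (simp add: add_increasing2)
next
  case False
  then have b: "0 < b" using assms by (smt (verit) mult_pos_pos)
  have "w powr (p - 1) * b \<le> (b / t) powr (p - 1) * b"
    using False assms by (intro mult_right_mono powr_mono2) (auto simp: field_simps)
  also have "\<dots> = t powr (1 - p) * b powr p"
    using b assms by (simp add: powr_divide powr_diff field_simps)
  finally show ?thesis using assms by (simp add: add_increasing)
qed

definition radial_trunc :: "real \<Rightarrow> 'b::euclidean_space \<Rightarrow> 'b" where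
  "radial_trunc m z = (m / max m (norm z)) *\<^sub>R z"

lemma radial_trunc:
  fixes z :: "'b::euclidean_space"
  assumes "0 < m"
  shows "norm (radial_trunc m z) \<le> m" "norm (radial_trunc m z) \<le> norm z"
    "norm z \<le> m \<Longrightarrow> radial_trunc m z = z" "continuous_on UNIV (radial_trunc m :: 'b \<Rightarrow> 'b)"
proof -
  have mx: "0 < max m (norm z)" for z :: 'b using assms by linarith
  have n: "norm (radial_trunc m z) = m / max m (norm z) * norm z"
    using assms by (simp add: radial_trunc_def)
  show "norm (radial_trunc m z) \<le> m" "norm (radial_trunc m z) \<le> norm z"
    unfolding n using assms by (auto simp: field_simps max_def mult_left_mono mult_right_mono)
  show "norm z \<le> m \<Longrightarrow> radial_trunc m z = z" using assms by (simp add: radial_trunc_def max_def)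
  show "continuous_on UNIV (radial_trunc m :: 'b \<Rightarrow> 'b)"
    unfolding radial_trunc_def[abs_def] using assms mx by (intro continuous_intros) (metis less_irrefl)
qed

lemma tendsto_norm_powr_0:
  fixes f :: "nat \<Rightarrow> 'a::real_normed_vector"
  assumes "f \<longlonglongrightarrow> l" "0 < p"
  shows "(\<lambda>n. norm (l - f n) powr p) \<longlonglongrightarrow> 0"
proof -
  have "(\<lambda>n. norm (l - f n)) \<longlonglongrightarrow> norm (l - l)"
    using assms(1) by (intro tendsto_intros)
  then have "(\<lambda>n. norm (l - f n)) \<longlonglongrightarrow> 0" by simp
  then have "(\<lambda>n. norm (l - f n) powr p) \<longlonglongrightarrow> 0 powr p"
    by (intro tendsto_powr2) (use assms in auto)
  then show ?thesis by simp
qed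

text \<open>Measurability gives continuous functions that converge to \<open>G\<close> almost everywhere. Truncating \<open>G\<close> and
  the approximants at the same height makes dominated convergence applicable.\<close>

lemma Lp_approx_continuous:
  fixes G :: "'a::euclidean_space \<Rightarrow> 'b::euclidean_space"
  assumes p: "1 < p" and [measurable]: "G \<in> borel_measurable borel"
    and int: "integrable lborel (\<lambda>x. norm (G x) powr p)"
    and L: "compact L" and \<eta>: "0 < \<eta>"
  shows "\<exists>g. continuous_on UNIV g \<and>
    (\<integral>\<^sup>+x. indicator L x * ennreal (norm (G x - g x) powr p) \<partial>lborel) \<le> ennreal \<eta>"
proof -
  have Lm [measurable]: "L \<in> sets borel" using L by (simp add: compact_imp_closed)
  have Lint: "integrable lborel (\<lambda>x. c * indicator L x :: real)" for c
    using emeasure_bounded_finite[of L] L by (auto simp: compact_imp_bounded)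
  define \<eta>' where "\<eta>' = \<eta> / (2 * 2 powr p)"
  have \<eta>': "0 < \<eta>'" using \<eta> by (simp add: \<eta>'_def)
  define T :: "nat \<Rightarrow> 'b \<Rightarrow> 'b" where "T m = radial_trunc (real (Suc m))" for m
  have T: "norm (T m z) \<le> real (Suc m)" "norm (T m z) \<le> norm z" "norm z \<le> real (Suc m) \<Longrightarrow> T m z = z"
      "continuous_on UNIV (T m)" for m z
    unfolding T_def using radial_trunc[of "real (Suc m)"] by auto
  have [measurable]: "T m \<in> borel_measurable borel" for m
    by (rule borel_measurable_continuous_onI[OF T(4)])
  have Tlim: "(\<lambda>m. T m z) \<longlonglongrightarrow> z" for z
  proof (rule tendsto_eventually)
    obtain m0 where "norm z \<le> real m0" using real_arch_simple by blast
    then show "\<forall>\<^sub>F m in sequentially. T m z = z"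
      by (intro eventually_sequentiallyI[of m0] T(3)) (auto intro: order_trans)
  qed
  have Tb: "norm (G x - T m (G x)) powr p \<le> 2 powr p * (norm (G x) powr p + norm (G x) powr p)" for m x
  proof -
    have "norm (G x - T m (G x)) \<le> norm (G x) + norm (G x)"
      using norm_triangle_ineq4[of "G x" "T m (G x)"] T(2)[of m "G x"] by linarith
    then have "norm (G x - T m (G x)) powr p \<le> (norm (G x) + norm (G x)) powr p"
      using p by (intro powr_mono2) auto
    also have "\<dots> \<le> 2 powr p * (norm (G x) powr p + norm (G x) powr p)"
      using p by (intro powr_add_le) auto
    finally show ?thesis .
  qed
  have "(\<lambda>m. LINT x|lborel. norm (G x - T m (G x)) powr p) \<longlonglongrightarrow> (LINT x::'a|lborel. 0)"
  proof (rule integral_dominated_convergence)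
    show "integrable lborel (\<lambda>x. 2 powr p * (norm (G x) powr p + norm (G x) powr p))"
      using int by auto
    show "AE x in lborel. (\<lambda>m. norm (G x - T m (G x)) powr p) \<longlonglongrightarrow> 0"
      by (intro AE_I2 tendsto_norm_powr_0 Tlim) (use p in auto)
    fix m
    show "AE x in lborel. norm (norm (G x - T m (G x)) powr p) \<le> 2 powr p * (norm (G x) powr p + norm (G x) powr p)"
      using Tb by (intro AE_I2) simp
  qed auto
  then have "\<forall>\<^sub>F m in sequentially. (LINT x|lborel. norm (G x - T m (G x)) powr p) < \<eta>'"
    using \<eta>' by (intro order_tendstoD) auto
  then obtain m where m: "(LINT x|lborel. norm (G x - T m (G x)) powr p) < \<eta>'"
    using eventually_happens'[OF sequentially_bot] by blast
  have im: "integrable lborel (\<lambda>x. norm (G x - T m (G x)) powr p)"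
  proof (rule Bochner_Integration.integrable_bound)
    show "integrable lborel (\<lambda>x. 2 powr p * (norm (G x) powr p + norm (G x) powr p))" using int by auto
    show "AE x in lborel. norm (norm (G x - T m (G x)) powr p) \<le> norm (2 powr p * (norm (G x) powr p + norm (G x) powr p))"
      using Tb by (intro AE_I2) simp
  qed auto
  have "G \<in> borel_measurable lebesgue" by (rule measurable_completion) simp
  then have "G measurable_on UNIV"
    by (intro lebesgue_measurable_imp_measurable_on) auto
  then obtain N g where N: "negligible N" and g: "\<And>n. continuous_on UNIV (g n)"
    and lim: "\<And>x. x \<notin> N \<Longrightarrow> (\<lambda>n. g n x) \<longlonglongrightarrow> G x"
    unfolding measurable_on_def by auto
  have [measurable]: "g n \<in> borel_measurable borel" for n by (rule borel_measurable_continuous_onI[OF g])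
  have "AE x in lebesgue. x \<notin> N" using N by (simp add: AE_not_in negligible_iff_null_sets)
  then have AEN: "AE x in lborel. x \<notin> N" by (simp add: AE_completion_iff)
  have Tg: "norm (T m z - T m z') powr p \<le> (2 * real (Suc m)) powr p" for z z'
    using norm_triangle_ineq4[of "T m z" "T m z'"] T(1)[of m z] T(1)[of m z'] p
    by (intro powr_mono2) auto
  have "(\<lambda>n. LINT x|lborel. indicator L x * norm (T m (G x) - T m (g n x)) powr p) \<longlonglongrightarrow> (LINT x::'a|lborel. 0)"
  proof (rule integral_dominated_convergence)
    show "integrable lborel (\<lambda>x. (2 * real (Suc m)) powr p * indicator L x)" by (rule Lint)
    show "AE x in lborel. (\<lambda>n. indicator L x * norm (T m (G x) - T m (g n x)) powr p) \<longlonglongrightarrow> 0"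
      using AEN
    proof eventually_elim
      case (elim x)
      have "isCont (T m) (G x)" using T(4) continuous_on_eq_continuous_at by blast
      then have "(\<lambda>n. T m (g n x)) \<longlonglongrightarrow> T m (G x)"
        using lim[OF elim] by (rule isCont_tendsto_compose)
      then show ?case using p by (intro tendsto_mult_right_zero tendsto_norm_powr_0) auto
    qed
    fix n
    show "AE x in lborel. norm (indicator L x * norm (T m (G x) - T m (g n x)) powr p) \<le> (2 * real (Suc m)) powr p * indicator L x"
      using Tg by (intro AE_I2) (auto simp: indicator_def)
  qed auto
  then have "\<forall>\<^sub>F n in sequentially. (LINT x|lborel. indicator L x * norm (T m (G x) - T m (g n x)) powr p) < \<eta>'"
    using \<eta>' by (intro order_tendstoD) auto
  then obtain n where n: "(LINT x|lborel. indicator L x * norm (T m (G x) - T m (g n x)) powr p) < \<eta>'"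
    using eventually_happens'[OF sequentially_bot] by blast
  have "integrable lborel (\<lambda>x. indicator L x * norm (T m (G x) - T m (g n x)) powr p)"
  proof (rule Bochner_Integration.integrable_bound)
    show "integrable lborel (\<lambda>x. (2 * real (Suc m)) powr p * indicator L x)" by (rule Lint)
    show "AE x in lborel. norm (indicator L x * norm (T m (G x) - T m (g n x)) powr p) \<le> norm ((2 * real (Suc m)) powr p * indicator L x :: real)"
      using Tg by (intro AE_I2) (auto simp: indicator_def)
  qed auto
  then have n': "(\<integral>\<^sup>+x. ennreal (indicator L x * norm (T m (G x) - T m (g n x)) powr p) \<partial>lborel) \<le> ennreal \<eta>'"
    using n by (subst nn_integral_eq_integral) (auto intro: ennreal_leI)
  have m': "(\<integral>\<^sup>+x. ennreal (norm (G x - T m (G x)) powr p) \<partial>lborel) \<le> ennreal \<eta>'"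
    using m im by (subst nn_integral_eq_integral) (auto intro: ennreal_leI)
  have pt: "indicator L x * ennreal (norm (G x - T m (g n x)) powr p) \<le> ennreal (2 powr p) *
     (ennreal (norm (G x - T m (G x)) powr p) + ennreal (indicator L x * norm (T m (G x) - T m (g n x)) powr p))" for x
  proof (cases "x \<in> L")
    case True
    have "norm (G x - T m (g n x)) \<le> norm (G x - T m (G x)) + norm (T m (G x) - T m (g n x))"
      using norm_triangle_ineq[of "G x - T m (G x)" "T m (G x) - T m (g n x)"] by simp
    then have "norm (G x - T m (g n x)) powr p \<le> (norm (G x - T m (G x)) + norm (T m (G x) - T m (g n x))) powr p"
      using p by (intro powr_mono2) auto
    also have "\<dots> \<le> 2 powr p * (norm (G x - T m (G x)) powr p + norm (T m (G x) - T m (g n x)) powr p)"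
      using p by (intro powr_add_le) auto
    finally show ?thesis using True by (simp add: ennreal_mult[symmetric] ennreal_plus[symmetric] ennreal_leI del: ennreal_plus)
  qed simp
  have "(\<integral>\<^sup>+x. indicator L x * ennreal (norm (G x - T m (g n x)) powr p) \<partial>lborel)
     \<le> (\<integral>\<^sup>+x. ennreal (2 powr p) * (ennreal (norm (G x - T m (G x)) powr p) + ennreal (indicator L x * norm (T m (G x) - T m (g n x)) powr p)) \<partial>lborel)"
    by (intro nn_integral_mono pt)
  also have "\<dots> = ennreal (2 powr p) * ((\<integral>\<^sup>+x. ennreal (norm (G x - T m (G x)) powr p) \<partial>lborel)
      + (\<integral>\<^sup>+x. ennreal (indicator L x * norm (T m (G x) - T m (g n x)) powr p) \<partial>lborel))"
    by (subst nn_integral_cmult) (auto simp: nn_integral_add)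
  also have "\<dots> \<le> ennreal (2 powr p) * (ennreal \<eta>' + ennreal \<eta>')"
    by (intro mult_left_mono add_mono m' n') auto
  also have "\<dots> = ennreal \<eta>"
    using \<eta>' \<eta> by (simp add: ennreal_mult[symmetric] ennreal_plus[symmetric] \<eta>'_def del: ennreal_plus)
  finally show ?thesis
    by (intro exI[of _ "\<lambda>x. T m (g n x)"] conjI continuous_on_compose2[OF T(4) g]) auto
qed

text \<open>The weight \<open>(1 + |G|)\<^sup>p\<^sup>-\<^sup>1\<close> is the growth of the \<open>p\<close>-Laplacian flux of \<open>G\<close>, so this is the convergence
  that is needed to replace \<open>G\<close> by its mollification inside the weak formulation. Split \<open>G = g + h\<close> with
  \<open>g\<close> continuous and \<open>h\<close> small in \<open>L\<^sup>p\<close>. The mollification of \<open>g\<close> converges uniformly. The weighted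
  integral of the mollification of \<open>h\<close> is bounded by Young's inequality and Tonelli's theorem, the kernel
  having integral 1 in either variable.\<close>

lemma mollify_weighted_limit:
  fixes G :: "'a::euclidean_space \<Rightarrow> 'b::euclidean_space"
  assumes p: "1 < p" and Gm [measurable]: "G \<in> borel_measurable borel"
    and int: "integrable lborel (\<lambda>x. norm (G x) powr p)"
    and int1: "integrable lborel G"
    and K: "compact K" and \<epsilon>: "0 < \<epsilon>"
  shows "\<exists>d0>0. \<forall>d. 0 < d \<and> d < d0 \<longrightarrow>
    (\<integral>\<^sup>+x. indicator K x * ennreal ((1 + norm (G x)) powr (p - 1) * norm (mollify d G x - G x)) \<partial>lborel) \<le> ennreal \<epsilon>"
proof -
  have Km [measurable]: "K \<in> sets borel" using K by (simp add: compact_imp_closed)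
  define w where "w x = 1 + norm (G x)" for x
  have [measurable]: "w \<in> borel_measurable borel" unfolding w_def[abs_def] by measurable
  have w1: "1 \<le> w x" for x by (simp add: w_def)
  \<comment> \<open>The values of a mollification with \<open>d < 1\<close> on \<open>K\<close> depend only on values in \<open>L\<close>.\<close>
  define L where "L = {x + y | x y. x \<in> K \<and> y \<in> cball 0 (1::real)}"
  have L: "compact L" unfolding L_def by (rule compact_sums) (use K in auto)
  have Lm [measurable]: "L \<in> sets borel" using L by (simp add: compact_imp_closed)
  have KL: "K \<subseteq> L" unfolding L_def by force
  have intw: "integrable lborel (\<lambda>x. indicator K x * w x powr p)"
  proof (rule Bochner_Integration.integrable_bound)
    show "integrable lborel (\<lambda>x. 2 powr p * (indicator K x + norm (G x) powr p))"
      using int emeasure_bounded_finite[of K] K by (auto simp: compact_imp_bounded)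
    show "AE x in lborel. norm (indicator K x * w x powr p) \<le> norm (2 powr p * (indicator K x + norm (G x) powr p))"
    proof (rule AE_I2)
      fix x
      show "norm (indicator K x * w x powr p) \<le> norm (2 powr p * (indicator K x + norm (G x) powr p))"
        using powr_add_le[of 1 "norm (G x)" p] p by (auto simp: indicator_def w_def)
    qed
  qed auto
  define A where "A = (LINT x|lborel. indicator K x * w x powr p)"
  have A0: "0 \<le> A" unfolding A_def by (intro Bochner_Integration.integral_nonneg) auto
  have A: "(\<integral>\<^sup>+x. ennreal (indicator K x * w x powr p) \<partial>lborel) = ennreal A"
    unfolding A_def using intw by (intro nn_integral_eq_integral) auto
  \<comment> \<open>First \<open>t\<close> is chosen to absorb the weight, then \<open>\<eta>\<close> so small that the factor \<open>t\<^sup>1\<^sup>-\<^sup>p\<close> of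
    Young's inequality is harmless.\<close>
  define t where "t = \<epsilon> / (8 * (A + 1))"
  have t: "0 < t" "t * A \<le> \<epsilon> / 8" using \<epsilon> A0 by (auto simp: t_def field_simps)
  define \<eta> where "\<eta> = \<epsilon> / 8 / t powr (1 - p)"
  have \<eta>: "0 < \<eta>" "t powr (1 - p) * \<eta> = \<epsilon> / 8" using \<epsilon> t by (auto simp: \<eta>_def)
  obtain g where g: "continuous_on UNIV g"
    and gG: "(\<integral>\<^sup>+x. indicator L x * ennreal (norm (G x - g x) powr p) \<partial>lborel) \<le> ennreal \<eta>"
    using Lp_approx_continuous[OF p Gm int L \<eta>(1)] by blast
  have [measurable]: "g \<in> borel_measurable borel" by (rule borel_measurable_continuous_onI[OF g])
  define h where "h x = indicator L x * norm (G x - g x)" for x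
  have [measurable]: "h \<in> borel_measurable borel" unfolding h_def[abs_def] by measurable
  have h0: "0 \<le> h x" for x by (simp add: h_def)
  have hI: "(\<integral>\<^sup>+x. ennreal (h x powr p) \<partial>lborel) \<le> ennreal \<eta>"
  proof -
    have "ennreal (h x powr p) = indicator L x * ennreal (norm (G x - g x) powr p)" for x
      using p by (auto simp: h_def indicator_def)
    then show ?thesis using gG by simp
  qed
  have young: "w x powr (p - 1) * b \<le> t * w x powr p + t powr (1 - p) * b powr p" if "0 \<le> b" for x b
    using weight_young[OF p t(1) w1 that] .
  define \<zeta> where "\<zeta> = \<epsilon> / (4 * (A + 1))"
  have \<zeta>: "0 < \<zeta>" "\<zeta> * A \<le> \<epsilon> / 4" using \<epsilon> A0 by (auto simp: \<zeta>_def field_simps)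
  obtain d0 where d0: "0 < d0" "\<And>d x. 0 < d \<Longrightarrow> d < d0 \<Longrightarrow> x \<in> K \<Longrightarrow> norm (mollify d g x - g x) \<le> \<zeta>"
    using mollify_uniform_limit[OF g K \<zeta>(1)] by blast
  show ?thesis
  proof (intro exI[of _ "min d0 1"] conjI allI impI)
    fix d assume "0 < d \<and> d < min d0 1"
    then have d: "0 < d" "d < d0" "d < 1" by auto
    note [measurable] = unit_bump_measurable[OF d(1)]
    define H where "H x = (\<integral>\<^sup>+y. ennreal (unit_bump d (x - y)) * ennreal (h y) \<partial>lborel)" for x
    have step: "ennreal (norm (mollify d G x - mollify d g x)) \<le> H x" if x: "x \<in> K" for x
    proof -
      have b: "\<exists>B. \<forall>z::'a. unit_bump d z \<le> B"
      proof -
        have "bounded (unit_bump d ` cball (0::'a) d)"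
          by (intro compact_imp_bounded compact_continuous_image continuous_on_unit_bump d) auto
        then obtain B where B: "\<And>z::'a. z \<in> cball 0 d \<Longrightarrow> \<bar>unit_bump d z\<bar> \<le> B" unfolding bounded_iff by (metis imageI real_norm_def)
        have "unit_bump d z \<le> max B 0" for z :: 'a
          using B[of z] unit_bump_eq_0[OF d(1), of z] by (cases "norm z \<le> d") auto
        then show ?thesis by blast
      qed
      then obtain B where B: "\<And>z::'a. unit_bump d z \<le> B" by blast
      have i1: "integrable lborel (\<lambda>y. unit_bump d (x - y) *\<^sub>R G y)"
      proof (rule Bochner_Integration.integrable_bound)
        show "integrable lborel (\<lambda>y. B *\<^sub>R G y)" using int1 by auto
        show "AE y in lborel. norm (unit_bump d (x - y) *\<^sub>R G y) \<le> norm (B *\<^sub>R G y)"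
        proof (rule AE_I2)
          fix y
          have "\<bar>unit_bump d (x - y)\<bar> \<le> \<bar>B\<bar>"
            using B[of "x - y"] unit_bump_nonneg[OF d(1), of "x - y"] by linarith
          then show "norm (unit_bump d (x - y) *\<^sub>R G y) \<le> norm (B *\<^sub>R G y)"
            by (simp add: mult_right_mono)
        qed
      qed measurable
      note i2 = integrable_unit_bump_scaleR[OF d(1) g, of x]
      have "ennreal (norm (mollify d G x - mollify d g x)) = ennreal (norm (LINT y|lborel. unit_bump d (x - y) *\<^sub>R G y - unit_bump d (x - y) *\<^sub>R g y))"
        unfolding mollify_def Bochner_Integration.integral_diff[OF i1 i2] ..
      also have "\<dots> \<le> (\<integral>\<^sup>+y. ennreal (norm (unit_bump d (x - y) *\<^sub>R G y - unit_bump d (x - y) *\<^sub>R g y)) \<partial>lborel)"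
        by (rule integral_norm_bound_ennreal) (use i1 i2 in auto)
      also have "\<dots> \<le> H x" unfolding H_def
      proof (rule nn_integral_mono)
        fix y
        show "ennreal (norm (unit_bump d (x - y) *\<^sub>R G y - unit_bump d (x - y) *\<^sub>R g y)) \<le> ennreal (unit_bump d (x - y)) * ennreal (h y)"
        proof (cases "norm (x - y) < d")
          case True
          then have "y \<in> L" unfolding L_def using x d
            by (intro CollectI exI[of _ x] exI[of _ "y - x"]) (auto simp: norm_minus_commute)
          then show ?thesis using unit_bump_nonneg[OF d(1), of "x - y"]
            by (simp add: scaleR_diff_right[symmetric] ennreal_mult h_def)
        next
          case False
          then show ?thesis using unit_bump_eq_0[OF d(1), of "x - y"] by simp
        qed
      qed
      finally show ?thesis .
    qed
    have T1: "(\<integral>\<^sup>+x. indicator K x * (ennreal (w x powr (p - 1)) * H x) \<partial>lborel) \<le> ennreal (\<epsilon> / 4)"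
    proof -
      have "(\<integral>\<^sup>+x. indicator K x * (ennreal (w x powr (p - 1)) * H x) \<partial>lborel)
          = (\<integral>\<^sup>+x. (\<integral>\<^sup>+y. indicator K x * (ennreal (w x powr (p - 1)) * (ennreal (unit_bump d (x - y)) * ennreal (h y))) \<partial>lborel) \<partial>lborel)"
        unfolding H_def by (intro nn_integral_cong) (simp add: nn_integral_cmult)
      also have "\<dots> \<le> (\<integral>\<^sup>+x. (\<integral>\<^sup>+y. ennreal (unit_bump d (x - y)) * (ennreal (t * (indicator K x * w x powr p)) + ennreal (t powr (1 - p) * h y powr p)) \<partial>lborel) \<partial>lborel)"
      proof (intro nn_integral_mono)
        fix x y
        show "indicator K x * (ennreal (w x powr (p - 1)) * (ennreal (unit_bump d (x - y)) * ennreal (h y)))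
           \<le> ennreal (unit_bump d (x - y)) * (ennreal (t * (indicator K x * w x powr p)) + ennreal (t powr (1 - p) * h y powr p))"
        proof (cases "x \<in> K")
          case True
          have "unit_bump d (x - y) * (w x powr (p - 1) * h y) \<le> unit_bump d (x - y) * (t * w x powr p + t powr (1 - p) * h y powr p)"
            using unit_bump_nonneg[OF d(1)] by (intro mult_left_mono young h0)
          then show ?thesis using True t h0 unit_bump_nonneg[OF d(1), of "x - y"]
            by (simp add: ennreal_mult[symmetric] ennreal_plus[symmetric] ennreal_leI mult_ac del: ennreal_plus)
        qed simp
      qed
      also have "\<dots> = (\<integral>\<^sup>+x. (\<integral>\<^sup>+y. ennreal (unit_bump d (x - y)) * ennreal (t * (indicator K x * w x powr p)) \<partial>lborel) \<partial>lborel)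
          + (\<integral>\<^sup>+x. (\<integral>\<^sup>+y. ennreal (unit_bump d (x - y)) * ennreal (t powr (1 - p) * h y powr p) \<partial>lborel) \<partial>lborel)"
      proof -
        have "(\<integral>\<^sup>+x. (\<integral>\<^sup>+y. ennreal (unit_bump d (x - y)) * (ennreal (t * (indicator K x * w x powr p)) + ennreal (t powr (1 - p) * h y powr p)) \<partial>lborel) \<partial>lborel)
          = (\<integral>\<^sup>+x. (\<integral>\<^sup>+y. ennreal (unit_bump d (x - y)) * ennreal (t * (indicator K x * w x powr p)) \<partial>lborel)
              + (\<integral>\<^sup>+y. ennreal (unit_bump d (x - y)) * ennreal (t powr (1 - p) * h y powr p) \<partial>lborel) \<partial>lborel)"
          unfolding distrib_left by (intro nn_integral_cong nn_integral_add) measurable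
        also have "\<dots> = (\<integral>\<^sup>+x. (\<integral>\<^sup>+y. ennreal (unit_bump d (x - y)) * ennreal (t * (indicator K x * w x powr p)) \<partial>lborel) \<partial>lborel)
          + (\<integral>\<^sup>+x. (\<integral>\<^sup>+y. ennreal (unit_bump d (x - y)) * ennreal (t powr (1 - p) * h y powr p) \<partial>lborel) \<partial>lborel)"
          by (rule nn_integral_add) measurable
        finally show ?thesis .
      qed
      also have "(\<integral>\<^sup>+x. (\<integral>\<^sup>+y. ennreal (unit_bump d (x - y)) * ennreal (t * (indicator K x * w x powr p)) \<partial>lborel) \<partial>lborel)
          = ennreal t * (\<integral>\<^sup>+x. ennreal (indicator K x * w x powr p) \<partial>lborel)"
        using t by (simp add: nn_integral_multc nn_integral_unit_bump'[OF d(1)] ennreal_mult nn_integral_cmult)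
      also have "(\<integral>\<^sup>+x. (\<integral>\<^sup>+y. ennreal (unit_bump d (x - y)) * ennreal (t powr (1 - p) * h y powr p) \<partial>lborel) \<partial>lborel)
          = (\<integral>\<^sup>+y. (\<integral>\<^sup>+x. ennreal (unit_bump d (x - y)) * ennreal (t powr (1 - p) * h y powr p) \<partial>lborel) \<partial>lborel)"
        by (rule lborel_pair.Fubini') measurable
      also have "\<dots> = ennreal (t powr (1 - p)) * (\<integral>\<^sup>+y. ennreal (h y powr p) \<partial>lborel)"
        by (simp add: nn_integral_multc nn_integral_unit_bump[OF d(1)] ennreal_mult nn_integral_cmult)
      also have "ennreal t * (\<integral>\<^sup>+x. ennreal (indicator K x * w x powr p) \<partial>lborel) + ennreal (t powr (1 - p)) * (\<integral>\<^sup>+y. ennreal (h y powr p) \<partial>lborel)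
         \<le> ennreal t * ennreal A + ennreal (t powr (1 - p)) * ennreal \<eta>"
        unfolding A by (intro add_mono mult_left_mono hI) auto
      also have "\<dots> = ennreal (t * A + t powr (1 - p) * \<eta>)"
        using t A0 \<eta> by (simp add: ennreal_mult[symmetric] ennreal_plus[symmetric] del: ennreal_plus)
      also have "\<dots> \<le> ennreal (\<epsilon> / 4)" using t(2) \<eta>(2) by (intro ennreal_leI) simp
      finally show ?thesis .
    qed
    have T2: "(\<integral>\<^sup>+x. indicator K x * ennreal (w x powr (p - 1) * \<zeta>) \<partial>lborel) \<le> ennreal (\<epsilon> / 4)"
    proof -
      have "(\<integral>\<^sup>+x. indicator K x * ennreal (w x powr (p - 1) * \<zeta>) \<partial>lborel) \<le> (\<integral>\<^sup>+x. ennreal \<zeta> * ennreal (indicator K x * w x powr p) \<partial>lborel)"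
      proof (rule nn_integral_mono)
        fix x
        have "w x powr (p - 1) \<le> w x powr p" using w1 by (intro powr_mono) auto
        then show "indicator K x * ennreal (w x powr (p - 1) * \<zeta>) \<le> ennreal \<zeta> * ennreal (indicator K x * w x powr p)"
          using \<zeta> by (auto simp: indicator_def ennreal_mult[symmetric] mult.commute intro!: ennreal_leI mult_left_mono)
      qed
      also have "\<dots> = ennreal \<zeta> * ennreal A" by (subst nn_integral_cmult) (auto simp: A)
      also have "\<dots> \<le> ennreal (\<epsilon> / 4)" using \<zeta> A0 by (simp add: ennreal_mult[symmetric] ennreal_leI)
      finally show ?thesis .
    qed
    have T3: "(\<integral>\<^sup>+x. indicator K x * ennreal (w x powr (p - 1) * h x) \<partial>lborel) \<le> ennreal (\<epsilon> / 4)"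
    proof -
      have "(\<integral>\<^sup>+x. indicator K x * ennreal (w x powr (p - 1) * h x) \<partial>lborel)
         \<le> (\<integral>\<^sup>+x. ennreal t * ennreal (indicator K x * w x powr p) + ennreal (t powr (1 - p)) * ennreal (h x powr p) \<partial>lborel)"
      proof (rule nn_integral_mono)
        fix x
        show "indicator K x * ennreal (w x powr (p - 1) * h x) \<le> ennreal t * ennreal (indicator K x * w x powr p) + ennreal (t powr (1 - p)) * ennreal (h x powr p)"
          using young[OF h0, of x x] t
          by (cases "x \<in> K") (simp_all add: ennreal_mult[symmetric] ennreal_plus[symmetric] ennreal_leI del: ennreal_plus)
      qed
      also have "\<dots> = ennreal t * ennreal A + ennreal (t powr (1 - p)) * (\<integral>\<^sup>+y. ennreal (h y powr p) \<partial>lborel)"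
        by (subst nn_integral_add) (auto simp: nn_integral_cmult A)
      also have "\<dots> \<le> ennreal t * ennreal A + ennreal (t powr (1 - p)) * ennreal \<eta>"
        by (intro add_mono mult_left_mono hI) auto
      also have "\<dots> = ennreal (t * A + t powr (1 - p) * \<eta>)"
        using t A0 \<eta> by (simp add: ennreal_mult[symmetric] ennreal_plus[symmetric] del: ennreal_plus)
      also have "\<dots> \<le> ennreal (\<epsilon> / 4)" using t(2) \<eta>(2) by (intro ennreal_leI) simp
      finally show ?thesis .
    qed
    have "(\<integral>\<^sup>+x. indicator K x * ennreal ((1 + norm (G x)) powr (p - 1) * norm (mollify d G x - G x)) \<partial>lborel)
       \<le> (\<integral>\<^sup>+x. indicator K x * (ennreal (w x powr (p - 1)) * H x) + (indicator K x * ennreal (w x powr (p - 1) * \<zeta>)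
            + indicator K x * ennreal (w x powr (p - 1) * h x)) \<partial>lborel)"
    proof (rule nn_integral_mono)
      fix x
      show "indicator K x * ennreal ((1 + norm (G x)) powr (p - 1) * norm (mollify d G x - G x))
        \<le> indicator K x * (ennreal (w x powr (p - 1)) * H x) + (indicator K x * ennreal (w x powr (p - 1) * \<zeta>)
            + indicator K x * ennreal (w x powr (p - 1) * h x))"
      proof (cases "x \<in> K")
        case True
        have hx: "h x = norm (G x - g x)" using True KL by (auto simp: h_def)
        have "norm (mollify d G x - G x) \<le> norm (mollify d G x - mollify d g x) + norm (mollify d g x - g x) + norm (g x - G x)"
          using norm_triangle_ineq[of "mollify d G x - mollify d g x" "mollify d g x - G x"]
            norm_triangle_ineq[of "mollify d g x - g x" "g x - G x"] by simp
        also have "\<dots> \<le> norm (mollify d G x - mollify d g x) + (\<zeta> + h x)"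
          using d0(2)[OF d(1,2) True] hx by (simp add: norm_minus_commute)
        finally have "ennreal (norm (mollify d G x - G x)) \<le> ennreal (norm (mollify d G x - mollify d g x)) + (ennreal \<zeta> + ennreal (h x))"
          using \<zeta> h0[of x] by (simp add: ennreal_plus[symmetric] ennreal_leI del: ennreal_plus)
        also have "\<dots> \<le> H x + (ennreal \<zeta> + ennreal (h x))"
          by (intro add_mono step[OF True]) auto
        finally have "ennreal (w x powr (p - 1)) * ennreal (norm (mollify d G x - G x)) \<le> ennreal (w x powr (p - 1)) * (H x + (ennreal \<zeta> + ennreal (h x)))"
          by (intro mult_left_mono) auto
        then show ?thesis using True \<zeta> h0[of x] by (simp add: w_def[symmetric] ennreal_mult distrib_left)
      qed simp
    qed
    also have "\<dots> = (\<integral>\<^sup>+x. indicator K x * (ennreal (w x powr (p - 1)) * H x) \<partial>lborel) + ((\<integral>\<^sup>+x. indicator K x * ennreal (w x powr (p - 1) * \<zeta>) \<partial>lborel)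
            + (\<integral>\<^sup>+x. indicator K x * ennreal (w x powr (p - 1) * h x) \<partial>lborel))"
      unfolding H_def by (subst nn_integral_add; (measurable)?) (subst nn_integral_add; (measurable)?)
    also have "\<dots> \<le> ennreal (\<epsilon> / 4) + (ennreal (\<epsilon> / 4) + ennreal (\<epsilon> / 4))"
      by (intro add_mono T1 T2 T3)
    also have "\<dots> = ennreal (\<epsilon> / 4 + (\<epsilon> / 4 + \<epsilon> / 4))" using \<epsilon> by (simp add: ennreal_plus[symmetric] del: ennreal_plus)
    also have "\<dots> \<le> ennreal \<epsilon>" using \<epsilon> by (intro ennreal_leI) simp
    finally show "(\<integral>\<^sup>+x. indicator K x * ennreal ((1 + norm (G x)) powr (p - 1) * norm (mollify d G x - G x)) \<partial>lborel) \<le> ennreal \<epsilon>" .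
  qed (use d0 in auto)
qed

section \<open>The comparison principle\<close>

text \<open>Tonelli's theorem is applied to Borel functions on the whole space, whereas a weak gradient is only
  Lebesgue measurable on \<open>\<Omega>\<close>.\<close>

lemma Lp_loc_borel_representative:
  fixes f :: "'a::euclidean_space \<Rightarrow> 'b::euclidean_space"
  assumes f: "f \<in> Lp_loc p \<Omega>" and p: "1 < p" and \<Omega>: "open \<Omega>" and L: "compact L" "L \<subseteq> \<Omega>"
  obtains G where "G \<in> borel_measurable borel" "\<And>x. x \<notin> L \<Longrightarrow> G x = 0"
    "AE x in lebesgue. x \<in> L \<longrightarrow> G x = f x"
    "integrable lborel (\<lambda>x. norm (G x) powr p)" "integrable lborel G"
proof -
  have Lm [measurable]: "L \<in> sets borel" using L by (simp add: compact_imp_closed)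
  have "f \<in> borel_measurable (lebesgue_on \<Omega>)" using f by (simp add: Lp_loc_def)
  then have "f \<in> borel_measurable (lebesgue_on L)"
    using L(2) by (rule measurable_restrict_mono)
  then have m0: "(\<lambda>x. if x \<in> L then f x else 0) \<in> borel_measurable lebesgue"
    by (subst (asm) borel_measurable_if[symmetric]) simp_all
  have "\<exists>g\<in>borel_measurable lborel. AE x in lborel. (if x \<in> L then f x else 0) \<bullet> b = g x" for b
    by (rule completion_ex_borel_measurable_real) (intro borel_measurable_inner m0 borel_measurable_const)
  then obtain g where g: "\<And>b. g b \<in> borel_measurable lborel" "\<And>b. AE x in lborel. (if x \<in> L then f x else 0) \<bullet> b = g b x"
    by metis
  have [measurable]: "g b \<in> borel_measurable borel" for b using g(1)[of b] by simp
  define G where "G x = indicator L x *\<^sub>R (\<Sum>b\<in>Basis. g b x *\<^sub>R b)" for x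
  have Gm [measurable]: "G \<in> borel_measurable borel" unfolding G_def[abs_def] by measurable
  have "AE x in lborel. \<forall>b\<in>Basis. (if x \<in> L then f x else 0) \<bullet> b = g b x"
    by (rule AE_finite_allI) (use g(2) in auto)
  then have "AE x in lborel. x \<in> L \<longrightarrow> G x = f x"
  proof eventually_elim
    case (elim x)
    show ?case
    proof
      assume "x \<in> L"
      then have "G x = (\<Sum>b\<in>Basis. (f x \<bullet> b) *\<^sub>R b)" using elim by (simp add: G_def)
      then show "G x = f x" by (simp add: euclidean_representation)
    qed
  qed
  then have AE: "AE x in lebesgue. x \<in> L \<longrightarrow> G x = f x" by (rule AE_completion)
  have "integrable (lebesgue_on L) (\<lambda>x. norm (f x) powr p)" using f L by (simp add: Lp_loc_def)
  then have "integrable lebesgue (\<lambda>x. indicator L x *\<^sub>R norm (f x) powr p)"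
    by (subst (asm) integrable_restrict_space) auto
  moreover have "AE x in lebesgue. indicator L x *\<^sub>R norm (f x) powr p = norm (G x) powr p"
    using AE by eventually_elim (auto simp: indicator_def G_def)
  moreover have "(\<lambda>x. norm (G x) powr p) \<in> borel_measurable lebesgue"
    by (rule measurable_completion) simp
  ultimately have "integrable lebesgue (\<lambda>x. norm (G x) powr p)"
    using integrable_cong_AE_imp by blast
  then have i: "integrable lborel (\<lambda>x. norm (G x) powr p)"
    by (subst (asm) integrable_completion) auto
  have "integrable lborel G"
  proof (rule Bochner_Integration.integrable_bound)
    show "integrable lborel (\<lambda>x. indicator L x + norm (G x) powr p)"
      using i emeasure_bounded_finite[of L] L by (auto simp: compact_imp_bounded)
    show "AE x in lborel. norm (G x) \<le> norm (indicator L x + norm (G x) powr p)"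
    proof (rule AE_I2)
      fix x
      show "norm (G x) \<le> norm (indicator L x + norm (G x) powr p)"
      proof (cases "x \<in> L \<and> 1 \<le> norm (G x)")
        case True
        then show ?thesis using powr_mono[of 1 p "norm (G x)"] p by simp
      next
        case False
        then consider "x \<notin> L" | "x \<in> L" "norm (G x) < 1" by fastforce
        then show ?thesis
        proof cases
          case 2
          have "norm (G x) \<le> 1 + norm (G x) powr p" using 2(2) by (simp add: add_increasing2)
          then show ?thesis using 2(1) by simp
        qed (simp add: G_def)
      qed
    qed
  qed simp
  moreover have "G x = 0" if "x \<notin> L" for x using that by (simp add: G_def)
  ultimately show ?thesis using that Gm AE i by blast
qed

lemma set_integral_eq_lborel:
  fixes F F' :: "'a::euclidean_space \<Rightarrow> 'b::euclidean_space"
  assumes F': "F' \<in> borel_measurable borel"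
    and AE: "AE x in lebesgue. indicator \<Omega> x *\<^sub>R F x = F' x"
  shows "(LINT x:\<Omega>|lebesgue. F x) = (LINT x|lborel. F' x)"
proof -
  have m: "F' \<in> borel_measurable lebesgue" using F' by (intro measurable_completion) simp
  have "AE x in lebesgue. F' x = indicator \<Omega> x *\<^sub>R F x" using AE by eventually_elim simp
  then have "(\<lambda>x. indicator \<Omega> x *\<^sub>R F x) \<in> borel_measurable lebesgue"
    by (rule borel_measurable_AE[OF m])
  then have "(LINT x:\<Omega>|lebesgue. F x) = (LINT x|lebesgue. F' x)"
    unfolding set_lebesgue_integral_def using m AE by (rule integral_cong_AE)
  also have "\<dots> = (LINT x|lborel. F' x)" using F' by (intro integral_completion) simp
  finally show ?thesis .
qed

text \<open>The kernel centred at \<open>x\<close> is an admissible function in the definition of the weak gradient. Therefore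
  the gradient of the mollification of \<open>u\<close> is the mollification of the weak gradient. Here \<open>u'\<close> is
  continuous on the whole space and agrees with \<open>u\<close> near \<open>x\<close>.\<close>

lemma mollify_weak_gradient:
  fixes u :: "'a::euclidean_space \<Rightarrow> real"
  assumes wg: "weak_gradient \<Omega> u D" and d: "0 < d" and L: "cball x d \<subseteq> L" "L \<subseteq> \<Omega>"
    and u': "continuous_on UNIV u'" "\<And>y. y \<in> L \<Longrightarrow> u' y = u y"
    and G: "G \<in> borel_measurable borel" "\<And>y. y \<notin> L \<Longrightarrow> G y = 0" "AE y in lebesgue. y \<in> L \<longrightarrow> G y = D y"
  shows "(LINT y|lborel. u' y *\<^sub>R unit_bump_grad d (x - y)) = mollify d G x"
proof -
  note [measurable] = G(1) unit_bump_measurable[OF d]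
  define \<phi> where "\<phi> y = unit_bump d (x - y)" for y
  have D: "GDERIV \<phi> y :> - unit_bump_grad d (x - y)" for y
  proof -
    have "((\<lambda>y. unit_bump d (x - y)) has_derivative (\<lambda>h. (- h) \<bullet> unit_bump_grad d (x - y))) (at y)"
      using GDERIV_unit_bump[OF d, of "x - y", unfolded gderiv_def]
      by (intro has_derivative_compose[where f="\<lambda>y. x - y" and g="unit_bump d" and g'="\<lambda>h. h \<bullet> unit_bump_grad d (x - y)"])
         (auto intro!: derivative_eq_intros)
    then show ?thesis by (simp add: gderiv_def \<phi>_def[abs_def])
  qed
  have gr: "grad \<phi> y = - unit_bump_grad d (x - y)" for y by (rule GDERIV_imp_grad[OF D])
  have cg: "continuous_on UNIV (\<lambda>y. - unit_bump_grad d (x - y))"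
    by (intro continuous_intros continuous_on_compose2[OF continuous_on_unit_bump_grad[OF d, of UNIV]]) auto
  have "\<phi> \<in> C1c \<Omega>"
    unfolding C1c_def
  proof (intro CollectI conjI allI exI[of _ "cball x d"])
    show "\<phi> differentiable at y" for y using D[of y] by (auto simp: gderiv_def differentiable_def)
    show "continuous_on UNIV (grad \<phi>)" using cg gr by (simp add: gr[abs_def])
    show "y \<notin> cball x d \<longrightarrow> \<phi> y = 0" for y using unit_bump_eq_0[OF d, of "x - y"] by (auto simp: \<phi>_def dist_norm)
  qed (use L in auto)
  then have "(LINT y:\<Omega>|lebesgue. u y *\<^sub>R grad \<phi> y) = - (LINT y:\<Omega>|lebesgue. \<phi> y *\<^sub>R D y)"
    using wg by (simp add: weak_gradient_def)
  also have "(LINT y:\<Omega>|lebesgue. \<phi> y *\<^sub>R D y) = (LINT y|lborel. unit_bump d (x - y) *\<^sub>R G y)"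
  proof (rule set_integral_eq_lborel)
    show "AE y in lebesgue. indicator \<Omega> y *\<^sub>R \<phi> y *\<^sub>R D y = unit_bump d (x - y) *\<^sub>R G y"
      using G(3)
    proof eventually_elim
      case (elim y)
      show ?case
      proof (cases "y \<in> L")
        case True
        then show ?thesis using elim L by (auto simp: \<phi>_def)
      next
        case False
        then have "\<phi> y = 0" using L(1) unit_bump_eq_0[OF d, of "x - y"] by (force simp: \<phi>_def dist_norm)
        then show ?thesis by (simp add: \<phi>_def)
      qed
    qed
  qed measurable
  also have "(LINT y:\<Omega>|lebesgue. u y *\<^sub>R grad \<phi> y) = (LINT y|lborel. u' y *\<^sub>R - unit_bump_grad d (x - y))"
  proof (rule set_integral_eq_lborel)
    show "(\<lambda>y. u' y *\<^sub>R - unit_bump_grad d (x - y)) \<in> borel_measurable borel"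
      by (intro borel_measurable_continuous_onI continuous_on_scaleR u'(1) cg)
    show "AE y in lebesgue. indicator \<Omega> y *\<^sub>R u y *\<^sub>R grad \<phi> y = u' y *\<^sub>R - unit_bump_grad d (x - y)"
    proof (rule AE_I2)
      fix y
      show "indicator \<Omega> y *\<^sub>R u y *\<^sub>R grad \<phi> y = u' y *\<^sub>R - unit_bump_grad d (x - y)"
      proof (cases "y \<in> L")
        case True
        then show ?thesis using L u'(2) by (auto simp: gr)
      next
        case False
        then have "unit_bump_grad d (x - y) = 0" using L(1) unit_bump_grad_eq_0[OF d, of "x - y"] by (force simp: dist_norm)
        then show ?thesis by (simp add: gr)
      qed
    qed
  qed
  finally show ?thesis by (simp add: mollify_def)
qed

definition flux :: "real \<Rightarrow> 'a::euclidean_space \<Rightarrow> 'a" where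
  "flux r z = norm z powr (r - 2) *\<^sub>R z"

lemma norm_flux: "norm (flux r z) = norm z powr (r - 1)"
proof (cases "z = 0")
  case False
  then show ?thesis using powr_add[of "norm z" "r - 2" 1] by (simp add: flux_def)
qed (simp add: flux_def)

lemma flux_measurable [measurable]: "flux r \<in> borel_measurable borel"
  unfolding flux_def[abs_def] by measurable

text \<open>By the Cauchy-Schwarz inequality this reduces to the monotonicity of \<open>t\<^sup>r\<^sup>-\<^sup>1\<close> for \<open>t \<ge> 0\<close>.\<close>

lemma flux_monotone:
  assumes "1 < r"
  shows "0 \<le> (flux r a - flux r b) \<bullet> (a - b)"
proof -
  have pw: "norm z powr (r - 2) * norm z = norm z powr (r - 1)" for z :: 'a
    using norm_flux[of r z] by (simp add: flux_def)
  have "0 \<le> (norm a powr (r - 1) - norm b powr (r - 1)) * (norm a - norm b)"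
  proof (cases "norm a \<le> norm b")
    case True
    then have "norm a powr (r - 1) \<le> norm b powr (r - 1)" using assms by (intro powr_mono2) auto
    then show ?thesis using True by (intro mult_nonpos_nonpos) auto
  next
    case False
    then have "norm b powr (r - 1) \<le> norm a powr (r - 1)" using assms by (intro powr_mono2) auto
    then show ?thesis using False by (intro mult_nonneg_nonneg) auto
  qed
  also have "\<dots> = norm a powr (r - 2) * (a \<bullet> a) + norm b powr (r - 2) * (b \<bullet> b)
      - (norm a powr (r - 2) + norm b powr (r - 2)) * (norm a * norm b)"
    unfolding pw[symmetric] dot_square_norm by (simp add: algebra_simps power2_eq_square)
  also have "\<dots> \<le> norm a powr (r - 2) * (a \<bullet> a) + norm b powr (r - 2) * (b \<bullet> b)
      - (norm a powr (r - 2) + norm b powr (r - 2)) * (a \<bullet> b)"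
    by (intro diff_left_mono mult_left_mono norm_cauchy_schwarz) auto
  also have "\<dots> = (flux r a - flux r b) \<bullet> (a - b)"
    by (simp add: flux_def inner_diff_left inner_diff_right algebra_simps inner_commute)
  finally show ?thesis .
qed

lemma norm_flux_le:
  assumes "1 < r" "r \<le> p"
  shows "norm (flux r z) \<le> (1 + norm z) powr (p - 1)"
proof -
  have "norm z powr (r - 1) \<le> (1 + norm z) powr (r - 1)" using assms by (intro powr_mono2) auto
  also have "\<dots> \<le> (1 + norm z) powr (p - 1)" using assms by (intro powr_mono) auto
  finally show ?thesis by (simp add: norm_flux)
qed

text \<open>A nonnegative solution together with a fixed choice of its weak gradient.\<close>

locale pq_supersolution =
  fixes p q s :: real and \<Omega> :: "'a::euclidean_space set" and u :: "'a \<Rightarrow> real" and Du :: "'a \<Rightarrow> 'a"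
  assumes q: "1 < q" and qp: "q < p" and s: "1 < s" and open_\<Omega>: "open \<Omega>"
    and cont: "continuous_on \<Omega> u" and nonneg: "\<And>x. x \<in> \<Omega> \<Longrightarrow> 0 \<le> u x"
    and Du: "Du \<in> Lp_loc p \<Omega>" and weak: "weak_gradient \<Omega> u Du"
    and super: "\<And>\<phi>. \<phi> \<in> C1c \<Omega> \<Longrightarrow> (\<And>x. x \<in> \<Omega> \<Longrightarrow> 0 \<le> \<phi> x) \<Longrightarrow>
       (LINT x:\<Omega>|lebesgue. u x powr (s - 1) * \<phi> x) \<le> laplacian_form p \<Omega> Du \<phi> + laplacian_form q \<Omega> Du \<phi>"
begin

lemma p: "1 < p" using q qp by linarith

text \<open>A strict subsolution \<open>v\<close>, with right-hand side \<open>f < u\<^sup>s\<^sup>-\<^sup>1\<close>, that lies below \<open>u\<close> on \<open>K - U\<close> lies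
  below \<open>u\<close> on \<open>K\<close>. Suppose that \<open>v > u\<close> somewhere and let \<open>ud\<close> be a mollification of \<open>u\<close>. For small \<open>\<epsilon> > 0\<close>
  and a small mollification radius the function \<open>\<phi> = ((v - ud - \<epsilon>)\<^sup>+)\<^sup>2\<close> has compact support in \<open>U\<close> and is continuously differentiable, so
  it is a test function. With \<open>A\<close> the sum of the two fluxes, \<open>G\<close> the gradient of \<open>u\<close> and \<open>Gd\<close> its mollification, subtraction of the two weak
  inequalities gives
  \<open>\<integral> (u\<^sup>s\<^sup>-\<^sup>1 - f) \<phi> \<le> - \<integral> w (A(\<nabla>v) - A(G)) \<bullet> (\<nabla>v - Gd)\<close>, \<open>w = 2 (v - ud - \<epsilon>)\<^sup>+\<close>.
  With \<open>G\<close> in place of \<open>Gd\<close> the right-hand side is at most zero by monotonicity, and the error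
  \<open>\<integral> (1 + |G|)\<^sup>p\<^sup>-\<^sup>1 |Gd - G|\<close> tends to zero with the mollification radius. The left-hand side, however,
  stays above a positive constant \<open>\<gamma>\<close> that comes from a fixed ball around a point where \<open>v > u\<close>.\<close>

lemma comparison_principle:
  assumes K: "compact K" "K \<subseteq> \<Omega>" and U: "open U" "U \<subseteq> K"
    and W: "open W" "K \<subseteq> W" "\<And>x. x \<in> W \<Longrightarrow> GDERIV v x :> Dv x" "continuous_on W Dv"
    and f: "continuous_on K f" "\<And>x. x \<in> U \<Longrightarrow> f x < u x powr (s - 1)"
    and sub: "\<And>\<phi> D C. (\<And>x. GDERIV \<phi> x :> D x) \<Longrightarrow> continuous_on UNIV D \<Longrightarrow> compact C \<Longrightarrow> C \<subseteq> U \<Longrightarrow>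
        (\<And>x. x \<notin> C \<Longrightarrow> \<phi> x = 0) \<Longrightarrow> (\<And>x. 0 \<le> \<phi> x) \<Longrightarrow>
        (LINT x|lborel. flux p (Dv x) \<bullet> D x) + (LINT x|lborel. flux q (Dv x) \<bullet> D x) \<le> (LINT x|lborel. f x * \<phi> x)"
    and bdry: "\<And>x. x \<in> K - U \<Longrightarrow> v x \<le> u x"
    and x: "x \<in> K"
  shows "v x \<le> u x"
proof (rule ccontr)
  assume "\<not> v x \<le> u x"
  define \<epsilon> where "\<epsilon> = (v x - u x) / 2"
  have \<epsilon>: "0 < \<epsilon>" "v x - u x - \<epsilon> = \<epsilon>" using \<open>\<not> v x \<le> u x\<close> by (auto simp: \<epsilon>_def field_simps)
  have xU: "x \<in> U" using bdry[of x] \<open>\<not> v x \<le> u x\<close> x by blast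
  have vW: "continuous_on W v" using W(3) GDERIV_isCont continuous_at_imp_continuous_on by blast
  have cK: "continuous_on K (\<lambda>x. v x - u x)"
    by (intro continuous_intros continuous_on_subset[OF vW] continuous_on_subset[OF cont] K W)
  define C where "C = {y \<in> K. \<epsilon> / 2 \<le> v y - u y}"
  have Cc: "compact C"
  proof -
    have "closed C" unfolding C_def
      by (intro continuous_closed_preimage_constant continuous_on_closed_Collect_le[OF continuous_on_const cK] compact_imp_closed K)
    then show ?thesis using compact_Int_closed[OF K(1), of C] by (simp add: C_def Int_absorb1 Collect_conj_eq)
  qed
  have CK: "C \<subseteq> K" by (auto simp: C_def)
  have CU: "C \<subseteq> U"
  proof
    fix y assume y: "y \<in> C"
    show "y \<in> U"
    proof (rule ccontr)
      assume "y \<notin> U"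
      then have "v y \<le> u y" using bdry[of y] y by (auto simp: C_def)
      then show False using y \<epsilon>(1) by (auto simp: C_def)
    qed
  qed
  have Cm [measurable]: "C \<in> sets borel" using Cc by (simp add: compact_imp_closed)
  have Km [measurable]: "K \<in> sets borel" using K by (simp add: compact_imp_closed)
  obtain e where e: "0 < e" "(\<Union>y\<in>K. cball y e) \<subseteq> \<Omega>"
    using compact_subset_open_imp_cball_epsilon_subset[OF K(1) open_\<Omega> K(2)] by blast
  define L where "L = {y + z | y z. y \<in> K \<and> z \<in> cball 0 e}"
  have L: "compact L" unfolding L_def by (rule compact_sums) (use K in auto)
  have cbL: "cball y d \<subseteq> L" if "y \<in> K" "d \<le> e" for y d
  proof
    fix z assume "z \<in> cball y d"
    then show "z \<in> L" unfolding L_def using that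
      by (intro CollectI exI[of _ y] exI[of _ "z - y"]) (auto simp: dist_norm norm_minus_commute)
  qed
  have L\<Omega>: "L \<subseteq> \<Omega>"
  proof
    fix z assume "z \<in> L"
    then obtain y w where "z = y + w" "y \<in> K" "norm w \<le> e" by (auto simp: L_def)
    then have "z \<in> cball y e" "y \<in> K" by (auto simp: dist_norm)
    then show "z \<in> \<Omega>" using e(2) by blast
  qed
  have KL: "K \<subseteq> L"
  proof
    fix y assume "y \<in> K"
    then show "y \<in> L" using cbL[of y 0] e(1) by auto
  qed
  obtain u' where u': "continuous_on UNIV u'" "\<And>y. y \<in> L \<Longrightarrow> u' y = u y"
  proof -
    have "closedin (top_of_set UNIV) L" using L by (simp add: compact_imp_closed)
    then show ?thesis using Tietze_unbounded[OF continuous_on_subset[OF cont L\<Omega>]] that by blast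
  qed
  obtain G where G [measurable]: "G \<in> borel_measurable borel" and G0: "\<And>x. x \<notin> L \<Longrightarrow> G x = 0"
    and GAE: "AE x in lebesgue. x \<in> L \<longrightarrow> G x = Du x"
    and Gp: "integrable lborel (\<lambda>x. norm (G x) powr p)" and G1: "integrable lborel G"
    by (rule Lp_loc_borel_representative[OF Du p open_\<Omega> L L\<Omega>]) (rule that)
  obtain M1 where M10: "0 \<le> M1" and "\<And>y. y \<in> K \<Longrightarrow> norm (v y - u y) \<le> M1"
    by (rule continuous_on_compact_bound[OF K(1) cK]) (rule that)
  then have M1: "\<bar>v y - u y\<bar> \<le> M1" if "y \<in> K" for y using that by simp
  obtain M2 where M20: "0 \<le> M2" and M2: "\<And>y. y \<in> K \<Longrightarrow> norm (Dv y) \<le> M2"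
    by (rule continuous_on_compact_bound[OF K(1) continuous_on_subset[OF W(4,2)]]) (rule that)
  define C0 where "C0 = 2 * (1 + M2) powr (p - 1) + 2"
  have C0: "0 < C0" unfolding C0_def by (simp add: add_nonneg_pos)
  \<comment> \<open>On the ball of radius \<open>\<rho>\<close> both factors of \<open>F \<phi>\<close> are bounded below independently of the
    mollification, which gives \<open>\<gamma>\<close>.\<close>
  define F where "F y = u y powr (s - 1) - f y" for y
  have F0: "0 < F y" if "y \<in> U" for y using f(2)[OF that] by (simp add: F_def)
  have Fc: "continuous_on K F"
    unfolding F_def[abs_def] using s nonneg K
    by (intro continuous_intros f continuous_on_powr' continuous_on_subset[OF cont]) auto
  have "isCont (\<lambda>y. v y - u y) x" "isCont F x"
    using cK Fc continuous_on_subset[OF _ U(2)] continuous_on_eq_continuous_at[OF U(1)] xU by blast+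
  then have "((\<lambda>y. v y - u y) \<longlongrightarrow> v x - u x) (nhds x)" "(F \<longlongrightarrow> F x) (nhds x)"
    unfolding continuous_within
    using tendsto_at_iff_tendsto_nhds[of "\<lambda>y. v y - u y" x] tendsto_at_iff_tendsto_nhds[of F x] by auto
  note this[THEN order_tendstoD(1)]
  moreover have "3/2 * \<epsilon> < v x - u x" "F x / 2 < F x" using \<epsilon> F0[OF xU] by auto
  ultimately have "\<forall>\<^sub>F y in nhds x. v y - u y > 3/2 * \<epsilon>" "\<forall>\<^sub>F y in nhds x. F y > F x / 2"
    by blast+
  then have "\<forall>\<^sub>F y in nhds x. v y - u y > 3/2 * \<epsilon> \<and> F y > F x / 2 \<and> y \<in> U"
    using eventually_nhds_in_open[OF U(1) xU] by eventually_elim auto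
  then obtain \<rho> where \<rho>: "0 < \<rho>" "\<And>y. y \<in> ball x \<rho> \<Longrightarrow> v y - u y > 3/2 * \<epsilon> \<and> F y > F x / 2 \<and> y \<in> U"
    unfolding eventually_nhds_metric mem_ball by (metis dist_commute)
  define \<gamma> where "\<gamma> = F x / 2 * (\<epsilon> / 4)\<^sup>2 * measure lborel (ball x \<rho>)"
  have \<gamma>: "0 < \<gamma>" unfolding \<gamma>_def using F0[OF xU] \<epsilon> content_ball_pos[OF \<rho>(1), of x] by simp
  \<comment> \<open>The constant \<open>2 M1 C0\<close> is the factor in front of the weighted mollification error.\<close>
  define \<delta> where "\<delta> = \<gamma> / (2 * (2 * M1 * C0 + 1))"
  have M1C0: "0 \<le> 2 * M1 * C0" using M10 C0 by simp
  have M1C0': "0 < 2 * M1 * C0 + 1" using M1C0 by linarith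
  have \<delta>: "0 < \<delta>" unfolding \<delta>_def by (intro divide_pos_pos mult_pos_pos \<gamma> M1C0') simp
  have \<delta>\<gamma>: "2 * M1 * C0 * \<delta> < \<gamma>"
  proof -
    have "2 * M1 * C0 * \<delta> \<le> (2 * M1 * C0 + 1) * \<delta>" using \<delta> by simp
    also have "\<dots> = \<gamma> / 2" unfolding \<delta>_def using M1C0' by (simp only: times_divide_eq_right mult.commute[of 2 "2 * M1 * C0 + 1"] mult_divide_mult_cancel_left_if) auto
    finally show ?thesis using \<gamma> by linarith
  qed
  obtain d1 where d1: "0 < d1" "\<And>d. 0 < d \<Longrightarrow> d < d1 \<Longrightarrow>
    (\<integral>\<^sup>+x. indicator K x * ennreal ((1 + norm (G x)) powr (p - 1) * norm (mollify d G x - G x)) \<partial>lborel) \<le> ennreal \<delta>"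
    using mollify_weighted_limit[OF p G Gp G1 K(1) \<delta>] by blast
  obtain d2 where d2: "0 < d2" "\<And>d y. 0 < d \<Longrightarrow> d < d2 \<Longrightarrow> y \<in> K \<Longrightarrow> norm (mollify d u' y - u' y) \<le> \<epsilon> / 4"
    using mollify_uniform_limit[OF u'(1) K(1), of "\<epsilon> / 4"] \<epsilon> by auto
  obtain d where d: "0 < d" "d < d1" "d < d2" "d < e"
  proof
    show "0 < min d1 (min d2 e) / 2" "min d1 (min d2 e) / 2 < d1" "min d1 (min d2 e) / 2 < d2" "min d1 (min d2 e) / 2 < e"
      using d1 d2 e by auto
  qed
  define ud where "ud = mollify d u'"
  define Gd where "Gd y = (LINT z|lborel. u' z *\<^sub>R unit_bump_grad d (y - z))" for y
  have ud: "GDERIV ud y :> Gd y" for y unfolding ud_def Gd_def by (rule GDERIV_mollify[OF d(1) u'(1)])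
  have Gdc: "continuous_on UNIV Gd" unfolding Gd_def[abs_def] by (rule GDERIV_mollify[OF d(1) u'(1)])
  have Gdm [measurable]: "Gd \<in> borel_measurable borel" by (rule borel_measurable_continuous_onI[OF Gdc])
  have GdG: "Gd y = mollify d G y" if "y \<in> K" for y
    unfolding Gd_def using mollify_weak_gradient[OF weak d(1) cbL[OF that] L\<Omega> u' G G0 GAE] d by auto
  have udu: "\<bar>ud y - u y\<bar> \<le> \<epsilon> / 4" if "y \<in> K" for y
    using d2(2)[OF d(1,3) that] u'(2)[of y] KL that by (auto simp: ud_def)
  have udc: "continuous_on UNIV ud" using ud GDERIV_isCont continuous_at_imp_continuous_on by blast
  \<comment> \<open>Outside \<open>C\<close> the excess \<open>v - ud - \<epsilon>\<close> is negative on \<open>U\<close>, so that the extension by zero is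
    continuously differentiable.\<close>
  define w where "w y = 2 * max 0 (v y - ud y - \<epsilon>)" for y
  define \<phi> where "\<phi> y = (if y \<in> C then possq (v y - ud y - \<epsilon>) else 0)" for y
  define D where "D y = (if y \<in> C then w y *\<^sub>R (Dv y - Gd y) else 0)" for y
  have neg: "v y - ud y - \<epsilon> \<le> 0" if "y \<in> U" "y \<notin> C" for y
  proof -
    have "y \<in> K" "v y - u y < \<epsilon> / 2" using that U(2) by (auto simp: C_def)
    then show ?thesis using udu[of y] \<epsilon>(1) by linarith
  qed
  have \<phi>U: "\<phi> y = possq (v y - ud y - \<epsilon>)" if "y \<in> U" for y
    using neg[OF that] by (auto simp: \<phi>_def possq_eq_0)
  have DU: "D y = w y *\<^sub>R (Dv y - Gd y)" if "y \<in> U" for y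
    using neg[OF that] by (auto simp: D_def w_def)
  have Dphi: "GDERIV \<phi> y :> D y" for y
  proof (cases "y \<in> U")
    case True
    then have "GDERIV (\<lambda>y. v y - ud y - \<epsilon>) y :> Dv y - Gd y - 0"
      by (intro GDERIV_diff GDERIV_const ud W(3)) (use U W in auto)
    then have "GDERIV (\<lambda>y. possq (v y - ud y - \<epsilon>)) y :> w y *\<^sub>R (Dv y - Gd y - 0)"
      unfolding w_def by (rule GDERIV_DERIV_compose[OF _ DERIV_possq])
    then have "GDERIV \<phi> y :> w y *\<^sub>R (Dv y - Gd y - 0)"
      by (rule GDERIV_transform_open[OF _ U(1) True]) (simp add: \<phi>U)
    then show ?thesis using True by (simp add: DU)
  next
    case False
    then have "y \<notin> C" using CU by auto
    have "GDERIV (\<lambda>y. 0) y :> 0" by (rule GDERIV_const)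
    then have "GDERIV \<phi> y :> 0"
      by (rule GDERIV_transform_open[where S="-C"]) (use \<open>y \<notin> C\<close> Cc compact_imp_closed in \<open>auto simp: \<phi>_def\<close>)
    then show ?thesis using \<open>y \<notin> C\<close> by (simp add: D_def)
  qed
  have Dc: "continuous_on UNIV D"
  proof -
    have "continuous_on U (\<lambda>y. w y *\<^sub>R (Dv y - Gd y))"
      unfolding w_def using U W
      by (intro continuous_intros continuous_on_subset[OF vW] continuous_on_subset[OF W(4)] continuous_on_subset[OF Gdc] continuous_on_subset[OF udc]) auto
    then have "continuous_on U D" by (rule continuous_on_eq) (simp add: DU)
    moreover have "continuous_on (-C) D"
      by (rule continuous_on_eq[OF continuous_on_const[of _ 0]]) (simp add: D_def)
    ultimately have "continuous_on (U \<union> -C) D"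
      using U(1) Cc compact_imp_closed by (intro continuous_on_open_Un) auto
    moreover have "U \<union> -C = UNIV" using CU by auto
    ultimately show ?thesis by simp
  qed
  have [measurable]: "D \<in> borel_measurable borel" by (rule borel_measurable_continuous_onI[OF Dc])
  have phic: "continuous_on UNIV \<phi>" using Dphi GDERIV_isCont continuous_at_imp_continuous_on by blast
  have [measurable]: "\<phi> \<in> borel_measurable borel" by (rule borel_measurable_continuous_onI[OF phic])
  have phi0: "0 \<le> \<phi> y" for y by (simp add: \<phi>_def possq_nonneg)
  have gr: "grad \<phi> y = D y" for y by (rule GDERIV_imp_grad[OF Dphi])
  have "\<phi> \<in> C1c \<Omega>"
    unfolding C1c_def
  proof (intro CollectI conjI allI exI[of _ C])
    show "\<phi> differentiable at y" for y using Dphi[of y] by (auto simp: gderiv_def differentiable_def)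
    show "continuous_on UNIV (grad \<phi>)" using Dc by (simp add: gr[abs_def])
  qed (use Cc CK K in \<open>auto simp: \<phi>_def\<close>)
  from super[OF this] phi0
  have "(LINT x:\<Omega>|lebesgue. u x powr (s - 1) * \<phi> x) \<le> laplacian_form p \<Omega> Du \<phi> + laplacian_form q \<Omega> Du \<phi>" by blast
  moreover have lf: "laplacian_form r \<Omega> Du \<phi> = (LINT x|lborel. flux r (G x) \<bullet> D x)" for r
    unfolding laplacian_form_def
  proof (rule set_integral_eq_lborel)
    show "AE x in lebesgue. indicator \<Omega> x *\<^sub>R ((norm (Du x) powr (r - 2) *\<^sub>R Du x) \<bullet> grad \<phi> x) = flux r (G x) \<bullet> D x"
      using GAE
    proof eventually_elim
      case (elim y)
      show ?case
      proof (cases "y \<in> C")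
        case True
        then have "y \<in> L" "y \<in> \<Omega>" using CK KL L\<Omega> by auto
        then show ?thesis using elim by (simp add: flux_def gr)
      qed (simp add: gr D_def)
    qed
  qed measurable
  moreover have "(LINT x:\<Omega>|lebesgue. u x powr (s - 1) * \<phi> x) = (LINT x|lborel. u' x powr (s - 1) * \<phi> x)"
  proof (rule set_integral_eq_lborel)
    have [measurable]: "u' \<in> borel_measurable borel" by (rule borel_measurable_continuous_onI[OF u'(1)])
    show "(\<lambda>x. u' x powr (s - 1) * \<phi> x) \<in> borel_measurable borel" by measurable
    show "AE x in lebesgue. indicator \<Omega> x *\<^sub>R (u x powr (s - 1) * \<phi> x) = u' x powr (s - 1) * \<phi> x"
    proof (rule AE_I2)
      fix y
      show "indicator \<Omega> y *\<^sub>R (u y powr (s - 1) * \<phi> y) = u' y powr (s - 1) * \<phi> y"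
      proof (cases "y \<in> C")
        case True
        then have "y \<in> L" "y \<in> \<Omega>" using CK KL L\<Omega> by auto
        then show ?thesis using u'(2) by simp
      qed (simp add: \<phi>_def)
    qed
  qed
  ultimately have ineq1: "(LINT x|lborel. u' x powr (s - 1) * \<phi> x) \<le> (LINT x|lborel. flux p (G x) \<bullet> D x) + (LINT x|lborel. flux q (G x) \<bullet> D x)"
    by simp
  have ineq2: "(LINT x|lborel. flux p (Dv x) \<bullet> D x) + (LINT x|lborel. flux q (Dv x) \<bullet> D x) \<le> (LINT x|lborel. f x * \<phi> x)"
    by (rule sub[OF Dphi Dc Cc CU]) (auto simp: phi0 \<phi>_def possq_nonneg)
  define Dv' where "Dv' y = indicator C y *\<^sub>R Dv y" for y
  have [measurable]: "Dv' \<in> borel_measurable borel"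
    unfolding Dv'_def[abs_def]
    by (intro borel_measurable_continuous_on_indicator continuous_on_subset[OF W(4)]) (use CK W in auto)
  have Dv'eq: "flux r (Dv y) \<bullet> D y = flux r (Dv' y) \<bullet> D y" for r y
    by (cases "y \<in> C") (auto simp: Dv'_def D_def)
  have Dv'M: "norm (Dv' y) \<le> M2" for y using M2[of y] CK M20 by (auto simp: Dv'_def indicator_def)
  obtain M3 where "0 \<le> M3" and M3: "\<And>y. y \<in> C \<Longrightarrow> norm (D y) \<le> M3"
    by (rule continuous_on_compact_bound[OF Cc continuous_on_subset[OF Dc subset_UNIV]]) (rule that)
  have M3': "norm (D y) \<le> \<bar>M3\<bar> * indicator C y" for y using M3[of y] by (auto simp: D_def indicator_def)
  have Cfin: "integrable lborel (\<lambda>y. c * indicator C y :: real)" for c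
    using emeasure_bounded_finite[of C] Cc by (auto simp: compact_imp_bounded)
  have wint: "integrable lborel (\<lambda>y. indicator C y * (1 + norm (G y)) powr (p - 1))"
  proof (rule Bochner_Integration.integrable_bound)
    show "integrable lborel (\<lambda>y. 2 powr p * (indicator C y + norm (G y) powr p))"
      using Gp Cfin[of 1] by auto
    show "AE y in lborel. norm (indicator C y * (1 + norm (G y)) powr (p - 1)) \<le> norm (2 powr p * (indicator C y + norm (G y) powr p))"
    proof (rule AE_I2)
      fix y
      have "(1 + norm (G y)) powr (p - 1) \<le> (1 + norm (G y)) powr p" by (intro powr_mono) auto
      also have "\<dots> \<le> 2 powr p * (1 powr p + norm (G y) powr p)" using p by (intro powr_add_le) auto
      finally show "norm (indicator C y * (1 + norm (G y)) powr (p - 1)) \<le> norm (2 powr p * (indicator C y + norm (G y) powr p))"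
        by (auto simp: indicator_def)
    qed
  qed measurable
  have iG: "integrable lborel (\<lambda>y. flux r (G y) \<bullet> D y)" if r: "1 < r" "r \<le> p" for r
  proof (rule Bochner_Integration.integrable_bound)
    show "integrable lborel (\<lambda>y. \<bar>M3\<bar> * (indicator C y * (1 + norm (G y)) powr (p - 1)))" using wint by auto
    show "AE y in lborel. norm (flux r (G y) \<bullet> D y) \<le> norm (\<bar>M3\<bar> * (indicator C y * (1 + norm (G y)) powr (p - 1)))"
    proof (rule AE_I2)
      fix y
      have "norm (flux r (G y) \<bullet> D y) \<le> norm (flux r (G y)) * norm (D y)"
        using Cauchy_Schwarz_ineq2[of "flux r (G y)" "D y"] by simp
      also have "\<dots> \<le> (1 + norm (G y)) powr (p - 1) * (\<bar>M3\<bar> * indicator C y)"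
        by (intro mult_mono norm_flux_le r M3') auto
      finally show "norm (flux r (G y) \<bullet> D y) \<le> norm (\<bar>M3\<bar> * (indicator C y * (1 + norm (G y)) powr (p - 1)))"
        by (simp add: abs_mult mult_ac)
    qed
  qed measurable
  have iv: "integrable lborel (\<lambda>y. flux r (Dv' y) \<bullet> D y)" if r: "1 < r" "r \<le> p" for r
  proof (rule Bochner_Integration.integrable_bound)
    show "integrable lborel (\<lambda>y. (1 + M2) powr (p - 1) * \<bar>M3\<bar> * indicator C y)" by (rule Cfin)
    show "AE y in lborel. norm (flux r (Dv' y) \<bullet> D y) \<le> norm ((1 + M2) powr (p - 1) * \<bar>M3\<bar> * indicator C y :: real)"
    proof (rule AE_I2)
      fix y
      have "norm (flux r (Dv' y) \<bullet> D y) \<le> norm (flux r (Dv' y)) * norm (D y)"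
        using Cauchy_Schwarz_ineq2[of "flux r (Dv' y)" "D y"] by simp
      also have "\<dots> \<le> (1 + norm (Dv' y)) powr (p - 1) * (\<bar>M3\<bar> * indicator C y)"
        by (intro mult_mono norm_flux_le r M3') auto
      also have "\<dots> \<le> (1 + M2) powr (p - 1) * (\<bar>M3\<bar> * indicator C y)"
        using Dv'M[of y] p by (intro mult_right_mono powr_mono2) auto
      finally show "norm (flux r (Dv' y) \<bullet> D y) \<le> norm ((1 + M2) powr (p - 1) * \<bar>M3\<bar> * indicator C y :: real)"
        by (simp add: abs_mult mult_ac)
    qed
  qed measurable
  have supp: "integrable lborel (\<lambda>y. h y * \<phi> y)" if h: "continuous_on K h" for h :: "'a \<Rightarrow> real"
  proof -
    have "integrable lborel (\<lambda>y. indicator C y *\<^sub>R (h y * \<phi> y))"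
      by (intro borel_integrable_compact Cc continuous_intros continuous_on_subset[OF h] CK continuous_on_subset[OF phic]) auto
    also have "(\<lambda>y. indicator C y *\<^sub>R (h y * \<phi> y)) = (\<lambda>y. h y * \<phi> y)"
      by (auto simp: fun_eq_iff indicator_def \<phi>_def)
    finally show ?thesis .
  qed
  have ip: "integrable lborel (\<lambda>y. u' y powr (s - 1) * \<phi> y)"
  proof (intro supp continuous_on_powr' continuous_on_subset[OF u'(1)] continuous_on_const ballI conjI impI)
    fix y assume "y \<in> K"
    then have "u' y = u y" "0 \<le> u y" using u'(2) KL K(2) nonneg by auto
    then show "0 \<le> u' y" by simp
  qed (use s in auto)
  have if': "integrable lborel (\<lambda>y. f y * \<phi> y)" by (rule supp[OF f(1)])
  have Fphi: "u' y powr (s - 1) * \<phi> y - f y * \<phi> y = F y * \<phi> y" for y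
    using u'(2)[of y] CK KL by (cases "y \<in> C") (auto simp: F_def \<phi>_def algebra_simps)
  have iF: "integrable lborel (\<lambda>y. F y * \<phi> y)" by (rule supp[OF Fc])
  define B where "B y = (flux p (Dv' y) - flux p (G y)) + (flux q (Dv' y) - flux q (G y))" for y
  have iB: "integrable lborel (\<lambda>y. B y \<bullet> D y)"
    unfolding B_def inner_add_left inner_diff_left using iG iv p q qp by auto
  have "(LINT y|lborel. F y * \<phi> y) = (LINT x|lborel. u' x powr (s - 1) * \<phi> x) - (LINT x|lborel. f x * \<phi> x)"
    using Bochner_Integration.integral_diff[OF ip if'] by (simp add: Fphi)
  also have "\<dots> \<le> - ((LINT x|lborel. flux p (Dv' x) \<bullet> D x) - (LINT x|lborel. flux p (G x) \<bullet> D x)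
      + ((LINT x|lborel. flux q (Dv' x) \<bullet> D x) - (LINT x|lborel. flux q (G x) \<bullet> D x)))"
    using ineq1 ineq2 unfolding Dv'eq by simp
  also have "\<dots> = (LINT y|lborel. - (B y \<bullet> D y))"
    unfolding B_def inner_add_left inner_diff_left using iG iv p q qp by simp
  also have "\<dots> \<le> 2 * M1 * C0 * \<delta>"
  proof -
    define R where "R y = indicator K y * ((1 + norm (G y)) powr (p - 1) * norm (Gd y - G y))" for y
    have Rm [measurable]: "R \<in> borel_measurable borel" unfolding R_def[abs_def] by measurable
    have R0: "0 \<le> R y" for y by (simp add: R_def)
    have "(\<integral>\<^sup>+y. ennreal (R y) \<partial>lborel) = (\<integral>\<^sup>+x. indicator K x * ennreal ((1 + norm (G x)) powr (p - 1) * norm (mollify d G x - G x)) \<partial>lborel)"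
      by (rule nn_integral_cong) (auto simp: R_def indicator_def GdG)
    then have Rn: "(\<integral>\<^sup>+y. ennreal (R y) \<partial>lborel) \<le> ennreal \<delta>" using d1(2)[OF d(1,2)] by simp
    have iR: "integrable lborel R"
      using Rn R0 by (intro integrableI_nonneg) (auto intro: le_less_trans)
    have "ennreal (LINT y|lborel. R y) \<le> ennreal \<delta>"
      using Rn nn_integral_eq_integral[OF iR] R0 by simp
    then have Rle: "(LINT y|lborel. R y) \<le> \<delta>" using \<delta> by (simp add: ennreal_le_iff)
    have "(LINT y|lborel. - (B y \<bullet> D y)) \<le> (LINT y|lborel. 2 * M1 * C0 * R y)"
    proof (rule integral_mono)
      show "integrable lborel (\<lambda>y. - (B y \<bullet> D y))" using iB by simp
      show "integrable lborel (\<lambda>y. 2 * M1 * C0 * R y)" using iR by simp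
      fix y
      show "- (B y \<bullet> D y) \<le> 2 * M1 * C0 * R y"
      proof (cases "y \<in> C")
        case False
        then show ?thesis using R0[of y] M1C0 by (simp add: D_def)
      next
        case True
        then have yK: "y \<in> K" using CK by auto
        have w0: "0 \<le> w y" by (simp add: w_def)
        have "v y - ud y - \<epsilon> \<le> M1" using M1[OF yK] udu[OF yK] \<epsilon>(1) by linarith
        then have w1: "w y \<le> 2 * M1" using M10 by (simp add: w_def)
        have mono: "0 \<le> B y \<bullet> (Dv' y - G y)"
          unfolding B_def inner_add_left using flux_monotone[of p "Dv' y" "G y"] flux_monotone[of q "Dv' y" "G y"] p q by linarith
        have "norm (B y) \<le> (norm (flux p (Dv' y)) + norm (flux p (G y))) + (norm (flux q (Dv' y)) + norm (flux q (G y)))"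
          unfolding B_def by (intro norm_triangle_le add_mono norm_triangle_ineq4)
        also have "\<dots> \<le> ((1 + norm (Dv' y)) powr (p - 1) + (1 + norm (G y)) powr (p - 1)) + ((1 + norm (Dv' y)) powr (p - 1) + (1 + norm (G y)) powr (p - 1))"
          using p q qp by (intro add_mono norm_flux_le) auto
        also have "\<dots> \<le> 2 * (1 + M2) powr (p - 1) + 2 * (1 + norm (G y)) powr (p - 1)"
          using powr_mono2[of "p - 1" "1 + norm (Dv' y)" "1 + M2"] Dv'M[of y] p by auto
        also have "\<dots> \<le> 2 * (1 + M2) powr (p - 1) * (1 + norm (G y)) powr (p - 1) + 2 * (1 + norm (G y)) powr (p - 1)"
          using ge_one_powr_ge_zero[of "1 + norm (G y)" "p - 1"] p by (simp add: mult_le_cancel_left1)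
        also have "\<dots> = C0 * (1 + norm (G y)) powr (p - 1)" by (simp add: C0_def algebra_simps)
        finally have nB: "norm (B y) \<le> C0 * (1 + norm (G y)) powr (p - 1)" .
        have "- (B y \<bullet> D y) = - (w y * (B y \<bullet> (Dv' y - G y))) + w y * (B y \<bullet> (Gd y - G y))"
          using True by (simp add: D_def Dv'_def inner_diff_right algebra_simps)
        also have "\<dots> \<le> w y * (B y \<bullet> (Gd y - G y))" using mono w0 by simp
        also have "\<dots> \<le> w y * (norm (B y) * norm (Gd y - G y))"
          by (intro mult_left_mono norm_cauchy_schwarz w0)
        also have "\<dots> \<le> (2 * M1) * (C0 * (1 + norm (G y)) powr (p - 1) * norm (Gd y - G y))"
          using w1 M10 by (intro mult_mono mult_right_mono nB) auto
        also have "\<dots> = 2 * M1 * C0 * R y" using yK by (simp add: R_def)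
        finally show ?thesis .
      qed
    qed
    also have "\<dots> \<le> 2 * M1 * C0 * \<delta>" using mult_left_mono[OF Rle M1C0] by simp
    finally show ?thesis .
  qed
  also have "\<dots> < \<gamma>" by (rule \<delta>\<gamma>)
  finally have up: "(LINT y|lborel. F y * \<phi> y) < \<gamma>" .
  have "\<gamma> = (LINT y|lborel. F x / 2 * (\<epsilon> / 4)\<^sup>2 * indicator (ball x \<rho>) y)"
    by (simp add: \<gamma>_def)
  also have "\<dots> \<le> (LINT y|lborel. F y * \<phi> y)"
  proof (rule integral_mono)
    show "integrable lborel (\<lambda>y. F x / 2 * (\<epsilon> / 4)\<^sup>2 * indicator (ball x \<rho>) y :: real)"
      using emeasure_bounded_finite[of "ball x \<rho>"] by auto
    fix y
    show "F x / 2 * (\<epsilon> / 4)\<^sup>2 * indicator (ball x \<rho>) y \<le> F y * \<phi> y"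
    proof (cases "y \<in> ball x \<rho>")
      case True
      have y: "v y - u y > 3/2 * \<epsilon>" "F y > F x / 2" "y \<in> U" using \<rho>(2)[OF True] by auto
      have "\<epsilon> / 4 \<le> v y - ud y - \<epsilon>" using y(1) udu[OF subsetD[OF U(2) y(3)]] by linarith
      then have "(\<epsilon> / 4)\<^sup>2 \<le> \<phi> y" unfolding \<phi>U[OF y(3)] possq_def using \<epsilon> by (intro power_mono) auto
      then have "F x / 2 * (\<epsilon> / 4)\<^sup>2 \<le> F y * \<phi> y"
        using y F0[OF xU] by (intro mult_mono) auto
      then show ?thesis using True by simp
    next
      case False
      have "0 \<le> F y * \<phi> y" 
      proof (cases "y \<in> C")
        case True
        then show ?thesis using F0[of y] CU phi0[of y] by (intro mult_nonneg_nonneg) (auto intro: less_imp_le)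
      qed (simp add: \<phi>_def)
      then show ?thesis using False by simp
    qed
  qed (rule iF)
  finally show False using up by linarith
qed

end

section \<open>Power barriers\<close>

text \<open>The value of \<open>-\<Delta>\<^sub>r (A + B |x|\<^sup>t)\<close> on the sphere of radius \<open>\<rho>\<close> in dimension \<open>N\<close>, where \<open>a = B t\<close>. The
  exponent of \<open>\<rho>\<close> is that of the flux field \<open>|y|\<^sup>e y\<close>, whose divergence contributes the factor \<open>N + e\<close>.\<close>

definition power_barrier_rhs :: "real \<Rightarrow> real \<Rightarrow> real \<Rightarrow> real \<Rightarrow> real \<Rightarrow> real" where
  "power_barrier_rhs N r a t \<rho> =
     - (sgn a * \<bar>a\<bar> powr (r - 1) * ((N + ((t - 1) * (r - 1) - 1)) * \<rho> powr ((t - 1) * (r - 1) - 1)))"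

lemma flux_power_gradient:
  fixes y :: "'a::euclidean_space"
  assumes "a \<noteq> 0"
  shows "flux r ((a * norm y powr (t - 2)) *\<^sub>R y) =
    (sgn a * \<bar>a\<bar> powr (r - 1)) *\<^sub>R (norm y powr ((t - 1) * (r - 1) - 1) *\<^sub>R y)"
proof (cases "y = 0")
  case False
  then have n: "0 < norm y" by simp
  have "norm ((a * norm y powr (t - 2)) *\<^sub>R y) = \<bar>a\<bar> * norm y powr (t - 1)"
    using n powr_add[of "norm y" "t - 2" 1] by (simp add: abs_mult)
  then have "flux r ((a * norm y powr (t - 2)) *\<^sub>R y)
      = (\<bar>a\<bar> powr (r - 2) * a * (norm y powr ((t - 1) * (r - 2)) * norm y powr (t - 2))) *\<^sub>R y"
    by (simp add: flux_def powr_mult powr_powr mult_ac)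
  also have "\<bar>a\<bar> powr (r - 2) * a = sgn a * \<bar>a\<bar> powr (r - 1)"
    using assms powr_add[of "\<bar>a\<bar>" "r - 2" 1] by (simp add: sgn_if abs_if)
  also have "norm y powr ((t - 1) * (r - 2)) * norm y powr (t - 2) = norm y powr ((t - 1) * (r - 1) - 1)"
    unfolding powr_add[symmetric] by (simp add: algebra_simps)
  finally show ?thesis by simp
qed (simp add: flux_def)

lemma GDERIV_power_barrier:
  fixes x0 :: "'a::euclidean_space"
  assumes "x \<noteq> x0 \<or> 1 < t"
  shows "GDERIV (\<lambda>x. A + B * norm (x - x0) powr t) x :> (B * t * norm (x - x0) powr (t - 2)) *\<^sub>R (x - x0)"
    and "isCont (\<lambda>x. (B * t * norm (x - x0) powr (t - 2)) *\<^sub>R (x - x0)) x"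
proof -
  have "GDERIV (\<lambda>x. norm (x - x0) powr t) x :> (t * norm (x - x0) powr (t - 2)) *\<^sub>R (x - x0)"
  proof (cases "x = x0")
    case False
    then show ?thesis by (rule GDERIV_norm_powr)
  next
    case True
    then have "1 < t" using assms by simp
    then have "GDERIV (\<lambda>x. norm (x - x0) powr t) x0 :> 0"
      by (rule GDERIV_at_order_gt_1[where C=1]) simp
    then show ?thesis using True by simp
  qed
  from GDERIV_add[OF GDERIV_const[of A] GDERIV_mult[OF GDERIV_const[of B] this]]
  show "GDERIV (\<lambda>x. A + B * norm (x - x0) powr t) x :> (B * t * norm (x - x0) powr (t - 2)) *\<^sub>R (x - x0)"
    by (rule GDERIV_subst) simp
  show "isCont (\<lambda>x. (B * t * norm (x - x0) powr (t - 2)) *\<^sub>R (x - x0)) x"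
  proof (cases "x = x0")
    case False
    then show ?thesis by (intro continuous_intros) auto
  next
    case True
    then have t: "1 < t" using assms by simp
    have "((\<lambda>x. norm (x - x0) powr (t - 1)) \<longlongrightarrow> norm (x0 - x0) powr (t - 1)) (at x0)"
      using t by (intro tendsto_intros) auto
    then have lim: "((\<lambda>x. \<bar>B * t\<bar> * norm (x - x0) powr (t - 1)) \<longlongrightarrow> 0) (at x0)"
      by (intro tendsto_mult_right_zero) simp
    have bound: "norm ((B * t * norm (x - x0) powr (t - 2)) *\<^sub>R (x - x0)) \<le> \<bar>B * t\<bar> * norm (x - x0) powr (t - 1)" for x
    proof (cases "x = x0")
      case False
      then show ?thesis using powr_add[of "norm (x - x0)" "t - 2" 1] by (simp add: abs_mult)
    qed simp
    have "((\<lambda>x. (B * t * norm (x - x0) powr (t - 2)) *\<^sub>R (x - x0)) \<longlongrightarrow> 0) (at x0)"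
      by (rule Lim_null_comparison[OF always_eventually lim]) (rule allI, rule bound)
    then show ?thesis unfolding True isCont_def by simp
  qed
qed

context pq_supersolution
begin

text \<open>The comparison principle for \<open>A + B |x - x0|\<^sup>t\<close>. If the centre lies in \<open>K\<close>, the condition on \<open>t\<close> makes
  both flux fields continuously differentiable there.\<close>

lemma power_barrier:
  assumes K: "compact K" "K \<subseteq> \<Omega>" and U: "open U" "U \<subseteq> K"
    and centre: "x0 \<notin> K \<or> 1 < (t - 1) * (q - 1)" and Bt: "B * t \<noteq> 0"
    and strict: "\<And>x. x \<in> U \<Longrightarrow> power_barrier_rhs DIM('a) p (B * t) t (norm (x - x0))
        + power_barrier_rhs DIM('a) q (B * t) t (norm (x - x0)) < u x powr (s - 1)"
    and bdry: "\<And>x. x \<in> K - U \<Longrightarrow> A + B * norm (x - x0) powr t \<le> u x"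
    and x: "x \<in> K"
  shows "A + B * norm (x - x0) powr t \<le> u x"
proof -
  define W where "W = (if x0 \<in> K then UNIV else -{x0})"
  have W: "open W" "K \<subseteq> W" by (auto simp: W_def)
  have t1: "1 < t" "0 < (t - 1) * (q - 1) - 1" "0 < (t - 1) * (p - 1) - 1" if "x0 \<in> K"
  proof -
    have c: "1 < (t - 1) * (q - 1)" using centre that by simp
    then have "0 < (t - 1) * (q - 1)" by linarith
    then show "1 < t" using q by (simp add: zero_less_mult_iff)
    then have "(t - 1) * (q - 1) \<le> (t - 1) * (p - 1)" using qp by (intro mult_left_mono) auto
    then show "0 < (t - 1) * (q - 1) - 1" "0 < (t - 1) * (p - 1) - 1" using c by linarith+
  qed
  have Wt: "x \<noteq> x0 \<or> 1 < t" if "x \<in> W" for x using that t1(1) by (cases "x0 \<in> K") (auto simp: W_def)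
  have ex: "x0 \<notin> K \<or> 0 < (t - 1) * (r - 1) - 1" if "r = p \<or> r = q" for r using t1(2,3) that by blast
  have rhs_cont: "continuous_on K (\<lambda>x. power_barrier_rhs DIM('a) r (B * t) t (norm (x - x0)))" if "r = p \<or> r = q" for r
  proof -
    have "continuous_on K (\<lambda>x. norm (x - x0) powr ((t - 1) * (r - 1) - 1))"
      using ex[OF that] by (intro continuous_on_powr' continuous_intros) auto
    then show ?thesis
      unfolding power_barrier_rhs_def by (intro continuous_on_minus continuous_on_mult continuous_on_const)
  qed
  show ?thesis
  proof (rule comparison_principle[OF K U W, where f = "\<lambda>x. power_barrier_rhs DIM('a) p (B * t) t (norm (x - x0))
        + power_barrier_rhs DIM('a) q (B * t) t (norm (x - x0))"])
    show "GDERIV (\<lambda>x. A + B * norm (x - x0) powr t) y :> (B * t * norm (y - x0) powr (t - 2)) *\<^sub>R (y - x0)" if "y \<in> W" for y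
      by (rule GDERIV_power_barrier(1)[OF Wt[OF that]])
    show "continuous_on W (\<lambda>x. (B * t * norm (x - x0) powr (t - 2)) *\<^sub>R (x - x0))"
      using GDERIV_power_barrier(2)[OF Wt] by (intro continuous_at_imp_continuous_on) auto
    show "continuous_on K (\<lambda>x. power_barrier_rhs DIM('a) p (B * t) t (norm (x - x0))
        + power_barrier_rhs DIM('a) q (B * t) t (norm (x - x0)))"
      by (intro continuous_on_add rhs_cont) auto
    fix \<phi> D and C :: "'a set"
    assume D: "\<And>x. GDERIV \<phi> x :> D x" "continuous_on UNIV D" and C: "compact C" "C \<subseteq> U" "\<And>x. x \<notin> C \<Longrightarrow> \<phi> x = 0"
    have one: "integrable lborel (\<lambda>x. power_barrier_rhs DIM('a) r (B * t) t (norm (x - x0)) * \<phi> x) \<and>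
       (LINT x|lborel. flux r ((B * t * norm (x - x0) powr (t - 2)) *\<^sub>R (x - x0)) \<bullet> D x)
        = (LINT x|lborel. power_barrier_rhs DIM('a) r (B * t) t (norm (x - x0)) * \<phi> x)" if r: "r = p \<or> r = q" for r
    proof -
      let ?e = "(t - 1) * (r - 1) - 1"
      let ?c = "sgn (B * t) * \<bar>B * t\<bar> powr (r - 1)"
      have e: "x0 \<notin> C \<or> 0 < ?e" using ex[OF r] C U by blast
      have I1: "integrable lborel (\<lambda>x. (real DIM('a) + ?e) * norm (x - x0) powr ?e * \<phi> x)"
        by (rule integral_power_field(1)[OF D C(1) _ e]) (rule C(3))
      have I2: "(LINT x|lborel. (norm (x - x0) powr ?e *\<^sub>R (x - x0)) \<bullet> D x)
          = - (LINT x|lborel. (real DIM('a) + ?e) * norm (x - x0) powr ?e * \<phi> x)"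
        by (rule integral_power_field(2)[OF D C(1) _ e]) (rule C(3))
      have rhs: "power_barrier_rhs DIM('a) r (B * t) t (norm (x - x0)) * \<phi> x
          = - ?c * ((real DIM('a) + ?e) * norm (x - x0) powr ?e * \<phi> x)" for x
        by (simp only: power_barrier_rhs_def mult_minus_left mult.assoc)
      have "(LINT x|lborel. flux r ((B * t * norm (x - x0) powr (t - 2)) *\<^sub>R (x - x0)) \<bullet> D x)
         = (LINT x|lborel. ?c * ((norm (x - x0) powr ?e *\<^sub>R (x - x0)) \<bullet> D x))"
        unfolding flux_power_gradient[OF Bt] by (simp only: inner_scaleR_left)
      also have "\<dots> = ?c * - (LINT x|lborel. (real DIM('a) + ?e) * norm (x - x0) powr ?e * \<phi> x)"
        by (simp only: integral_mult_right_zero I2)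
      also have "\<dots> = (LINT x|lborel. power_barrier_rhs DIM('a) r (B * t) t (norm (x - x0)) * \<phi> x)"
        unfolding rhs integral_mult_right_zero by (simp only: mult_minus_left mult_minus_right)
      finally have eq: "(LINT x|lborel. flux r ((B * t * norm (x - x0) powr (t - 2)) *\<^sub>R (x - x0)) \<bullet> D x)
        = (LINT x|lborel. power_barrier_rhs DIM('a) r (B * t) t (norm (x - x0)) * \<phi> x)" .
      have "integrable lborel (\<lambda>x. power_barrier_rhs DIM('a) r (B * t) t (norm (x - x0)) * \<phi> x)"
        unfolding rhs by (rule integrable_mult_right) (rule I1)
      with eq show ?thesis by (intro conjI)
    qed
    show "(LINT x|lborel. flux p ((B * t * norm (x - x0) powr (t - 2)) *\<^sub>R (x - x0)) \<bullet> D x)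
       + (LINT x|lborel. flux q ((B * t * norm (x - x0) powr (t - 2)) *\<^sub>R (x - x0)) \<bullet> D x)
       \<le> (LINT x|lborel. (power_barrier_rhs DIM('a) p (B * t) t (norm (x - x0)) + power_barrier_rhs DIM('a) q (B * t) t (norm (x - x0))) * \<phi> x)"
    proof -
      note P = one[of p, OF disjI1[OF refl]] and Q = one[of q, OF disjI2[OF refl]]
      show ?thesis
        unfolding distrib_right Bochner_Integration.integral_add[OF P[THEN conjunct1] Q[THEN conjunct1]]
          P[THEN conjunct2] Q[THEN conjunct2] by (rule order_refl)
    qed
  qed (erule strict, erule bdry, rule x)
qed

text \<open>The sign condition makes the barrier a strict subsolution of the homogeneous equation for both
  exponents at once. This is enough for comparison with \<open>u\<close>, because \<open>u\<^sup>s\<^sup>-\<^sup>1 \<ge> 0\<close>.\<close>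

lemma annulus_barrier:
  assumes r: "0 < rin" and sub: "\<And>x. rin \<le> norm (x - x0) \<Longrightarrow> norm (x - x0) \<le> rout \<Longrightarrow> x \<in> \<Omega>"
    and Bt: "B * t \<noteq> 0"
    and neg: "\<And>r. r = p \<or> r = q \<Longrightarrow> 0 < sgn (B * t) * (real DIM('a) + ((t - 1) * (r - 1) - 1))"
    and b1: "\<And>x. norm (x - x0) = rin \<Longrightarrow> x \<in> \<Omega> \<Longrightarrow> A + B * rin powr t \<le> u x"
    and b2: "\<And>x. norm (x - x0) = rout \<Longrightarrow> x \<in> \<Omega> \<Longrightarrow> A + B * rout powr t \<le> u x"
    and x: "rin \<le> norm (x - x0)" "norm (x - x0) \<le> rout"
  shows "A + B * norm (x - x0) powr t \<le> u x"
proof (rule power_barrier[where K = "{x. rin \<le> norm (x - x0) \<and> norm (x - x0) \<le> rout}" and U = "{x. rin < norm (x - x0) \<and> norm (x - x0) < rout}"])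
  show "compact {x. rin \<le> norm (x - x0) \<and> norm (x - x0) \<le> rout}"
  proof -
    have "{x. rin \<le> norm (x - x0) \<and> norm (x - x0) \<le> rout} = cball x0 rout \<inter> {x. rin \<le> norm (x - x0)}"
      by (auto simp: dist_norm norm_minus_commute)
    moreover have "closed {x. rin \<le> norm (x - x0)}" by (intro closed_Collect_le continuous_intros)
    ultimately show ?thesis by (simp add: compact_Int_closed)
  qed
  show "open {x. rin < norm (x - x0) \<and> norm (x - x0) < rout}"
    by (intro open_Collect_conj open_Collect_less continuous_intros)
  show "x0 \<notin> {x. rin \<le> norm (x - x0) \<and> norm (x - x0) \<le> rout} \<or> 1 < (t - 1) * (q - 1)" using r by simp
  fix y assume y: "y \<in> {x. rin < norm (x - x0) \<and> norm (x - x0) < rout}"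
  have "power_barrier_rhs DIM('a) r (B * t) t (norm (y - x0)) < 0" if "r = p \<or> r = q" for r
  proof -
    have "0 < \<bar>B * t\<bar> powr (r - 1) * norm (y - x0) powr ((t - 1) * (r - 1) - 1) * (sgn (B * t) * (real DIM('a) + ((t - 1) * (r - 1) - 1)))"
    proof (intro mult_pos_pos[OF mult_pos_pos] neg that)
      have "0 < \<bar>B * t\<bar>" "0 < norm (y - x0)" using Bt y r by auto
      then show "0 < \<bar>B * t\<bar> powr (r - 1)" "0 < norm (y - x0) powr ((t - 1) * (r - 1) - 1)"
        by (simp_all only: powr_gt_zero)
    qed
    then show ?thesis by (simp add: power_barrier_rhs_def mult_ac)
  qed
  from this[of p] this[of q] powr_ge_zero[of "u y" "s - 1"] show "power_barrier_rhs DIM('a) p (B * t) t (norm (y - x0)) + power_barrier_rhs DIM('a) q (B * t) t (norm (y - x0)) < u y powr (s - 1)"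
    by linarith
next
  fix y assume "y \<in> {x. rin \<le> norm (x - x0) \<and> norm (x - x0) \<le> rout} - {x. rin < norm (x - x0) \<and> norm (x - x0) < rout}"
  then have "y \<in> \<Omega>" "norm (y - x0) = rin \<or> norm (y - x0) = rout" using sub by auto
  then show "A + B * norm (y - x0) powr t \<le> u y" using b1 b2 by auto
next
  show "{x. rin \<le> norm (x - x0) \<and> norm (x - x0) \<le> rout} \<subseteq> \<Omega>" using sub by blast
  show "x \<in> {x. rin \<le> norm (x - x0) \<and> norm (x - x0) \<le> rout}" using x by simp
  show "B * t \<noteq> 0" by (rule Bt)
qed force

text \<open>The fundamental solution of the \<open>q\<close>-Laplacian decays like \<open>|x|\<close> to the power \<open>-(N - q) / (q - 1)\<close>. A barrier
  that decays faster is a strict subsolution for \<open>q\<close>, and even more so for \<open>p > q\<close>.\<close>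

lemma decreasing_barrier_sign:
  assumes "0 < B" "0 < \<beta>" "real DIM('a) - 1 < (\<beta> + 1) * (q - 1)" "r = p \<or> r = q"
  shows "0 < sgn (B * - \<beta>) * (real DIM('a) + ((- \<beta> - 1) * (r - 1) - 1))"
proof -
  have "(\<beta> + 1) * (q - 1) \<le> (\<beta> + 1) * (r - 1)" using assms qp by (intro mult_left_mono) auto
  moreover have "(- \<beta> - 1) * (r - 1) = - ((\<beta> + 1) * (r - 1))" by (simp add: algebra_simps)
  ultimately have "real DIM('a) + ((- \<beta> - 1) * (r - 1) - 1) < 0" using assms(3) by linarith
  moreover have "sgn (B * - \<beta>) = -1" using assms by (simp add: sgn_mult)
  ultimately show ?thesis by simp
qed

section \<open>The strong maximum principle\<close>

text \<open>A decreasing power barrier around \<open>x0\<close> that vanishes on the sphere of radius \<open>R\<close> lies below \<open>u\<close> near \<open>x0\<close>,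
  hence in the whole ball, where it is positive.\<close>

lemma positive_on_ball:
  assumes sub: "cball x0 R \<subseteq> \<Omega>" and pos: "0 < u x0" and x: "x \<in> ball x0 R"
  shows "0 < u x"
proof -
  have R: "0 < R" using x by (metis ball_eq_empty empty_iff not_le)
  define \<beta> where "\<beta> = real DIM('a) / (q - 1)"
  have \<beta>: "0 < \<beta>" "real DIM('a) - 1 < (\<beta> + 1) * (q - 1)"
    using q by (auto simp: \<beta>_def field_simps)
  have "x0 \<in> \<Omega>" using sub R by auto
  then have "isCont u x0" using cont open_\<Omega> continuous_on_eq_continuous_at by blast
  then have "(u \<longlongrightarrow> u x0) (nhds x0)" using tendsto_at_iff_tendsto_nhds[of u x0] by (simp add: continuous_within)
  then have "\<forall>\<^sub>F y in nhds x0. u x0 / 2 < u y" using pos by (intro order_tendstoD(1)) auto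
  then obtain d where d: "0 < d" "\<And>y. dist y x0 < d \<Longrightarrow> u x0 / 2 < u y"
    unfolding eventually_nhds_metric by blast
  define r1 where "r1 = min d R / 2"
  have r1: "0 < r1" "r1 < d" "r1 < R" using d R by (auto simp: r1_def)
  show ?thesis
  proof (cases "norm (x - x0) \<le> r1")
    case True
    then show ?thesis using d(2)[of x] r1 pos by (simp add: dist_norm)
  next
    case False
    define B where "B = u x0 / 2 * r1 powr \<beta>"
    have B: "0 < B" unfolding B_def using pos r1 by simp
    have "B * norm (x - x0) powr - \<beta> > B * R powr - \<beta>"
    proof -
      have "norm (x - x0) < R" using x by (simp add: dist_norm norm_minus_commute)
      then have "R powr - \<beta> < norm (x - x0) powr - \<beta>"
        using False r1 \<beta> by (intro powr_less_mono2_neg) auto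
      then show ?thesis using B by simp
    qed
    moreover have "- (B * R powr - \<beta>) + B * norm (x - x0) powr - \<beta> \<le> u x"
    proof (rule annulus_barrier[where rin = r1 and rout = R])
      show "y \<in> \<Omega>" if "norm (y - x0) \<le> R" for y
        using that sub by (auto simp: dist_norm norm_minus_commute)
      show "0 < sgn (B * - \<beta>) * (real DIM('a) + ((- \<beta> - 1) * (r - 1) - 1))" if "r = p \<or> r = q" for r
        using decreasing_barrier_sign[OF B \<beta> that] .
      show "- (B * R powr - \<beta>) + B * r1 powr - \<beta> \<le> u y" if "norm (y - x0) = r1" for y
      proof -
        have "B * r1 powr - \<beta> = u x0 / 2" using r1 by (simp add: B_def powr_minus)
        moreover have "0 \<le> B * R powr - \<beta>" using B by simp
        ultimately show ?thesis using d(2)[of y] that r1 by (simp add: dist_norm)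
      qed
    qed (use r1 B \<beta> nonneg False x in \<open>auto simp: dist_norm norm_minus_commute\<close>)
    ultimately show ?thesis by linarith
  qed
qed

text \<open>If \<open>u z > 0\<close> then \<open>u\<close> is positive on every ball around \<open>z\<close> whose closure stays inside \<open>\<Omega>\<close>, with a radius that does
  not shrink as \<open>z\<close> approaches a zero of \<open>u\<close> in \<open>\<Omega>\<close>. So the positivity set is open and relatively closed.\<close>

lemma strong_maximum_principle:
  assumes conn: "connected \<Omega>" and x1: "x1 \<in> \<Omega>" "u x1 \<noteq> 0" and x: "x \<in> \<Omega>"
  shows "0 < u x"
proof (rule ccontr)
  assume "\<not> 0 < u x"
  define S where "S = {y \<in> \<Omega>. 0 < u y}"
  have "open S"
    unfolding open_contains_ball
  proof
    fix y assume y: "y \<in> S"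
    then obtain e where e: "0 < e" "cball y e \<subseteq> \<Omega>" using open_\<Omega> open_contains_cball unfolding S_def by blast
    have "ball y e \<subseteq> S"
    proof
      fix z assume z: "z \<in> ball y e"
      have "0 < u z" by (rule positive_on_ball[OF e(2) _ z]) (use y in \<open>simp add: S_def\<close>)
      moreover have "z \<in> \<Omega>" using z e(2) by (auto simp: subset_iff)
      ultimately show "z \<in> S" by (simp add: S_def)
    qed
    then show "\<exists>e>0. ball y e \<subseteq> S" using e by blast
  qed
  moreover have "open (\<Omega> - S)"
    unfolding open_contains_ball
  proof
    fix y assume y: "y \<in> \<Omega> - S"
    then obtain e where e: "0 < e" "cball y e \<subseteq> \<Omega>" using open_\<Omega> open_contains_cball by blast
    have "ball y (e/3) \<subseteq> \<Omega> - S"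
    proof
      fix z assume z: "z \<in> ball y (e/3)"
      have "cball z (2 * e / 3) \<subseteq> cball y e"
      proof
        fix w assume "w \<in> cball z (2 * e / 3)"
        then show "w \<in> cball y e" using z dist_triangle[of y w z] by simp
      qed
      then have cb: "cball z (2 * e / 3) \<subseteq> \<Omega>" using e by blast
      have "z \<notin> S"
      proof
        assume "z \<in> S"
        have "0 < u y"
          by (rule positive_on_ball[OF cb]) (use \<open>z \<in> S\<close> z e in \<open>auto simp: S_def dist_commute\<close>)
        then show False using y by (auto simp: S_def)
      qed
      moreover have "z \<in> \<Omega>" using z e by (auto simp: subset_iff)
      ultimately show "z \<in> \<Omega> - S" by simp
    qed
    then show "\<exists>e>0. ball y e \<subseteq> \<Omega> - S" using e by (intro exI[of _ "e/3"]) auto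
  qed
  moreover have "x1 \<in> S" using x1 nonneg[of x1] by (auto simp: S_def)
  moreover have "x \<in> \<Omega> - S" using x \<open>\<not> 0 < u x\<close> by (simp add: S_def)
  ultimately show False
    using connectedD[OF conn, of S "\<Omega> - S"] x1 x by auto
qed

section \<open>Lower bounds at infinity\<close>

text \<open>The exponent may be negative: it is a decay rate at first and is raised step by step.\<close>

definition grows_like :: "real \<Rightarrow> bool" where
  "grows_like m \<longleftrightarrow> (\<exists>c>0. \<exists>R\<ge>1. \<forall>x. R \<le> norm x \<longrightarrow> x \<in> \<Omega> \<and> c * norm x powr m \<le> u x)"

text \<open>Comparison on the annuli \<open>r1 \<le> |x| \<le> \<rho>\<close> with a decreasing power that vanishes at \<open>\<rho>\<close>; then \<open>\<rho>\<close> tends to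
  infinity.\<close>

lemma grows_like_initial:
  assumes R: "\<And>x. R < norm x \<Longrightarrow> x \<in> \<Omega>" and pos: "\<And>x. x \<in> \<Omega> \<Longrightarrow> 0 < u x"
    and \<beta>: "0 < \<beta>" "real DIM('a) - 1 < (\<beta> + 1) * (q - 1)"
  shows "grows_like (- \<beta>)"
proof -
  define r1 where "r1 = max R 0 + 1"
  have r1: "1 \<le> r1" "R < r1" by (auto simp: r1_def)
  have sub: "sphere 0 r1 \<subseteq> \<Omega>" using R r1 by auto
  obtain b :: 'a where b: "norm b = r1" using vector_choose_size[of r1] r1 by auto
  obtain z where z: "z \<in> sphere 0 r1" "\<And>y. y \<in> sphere 0 r1 \<Longrightarrow> u z \<le> u y"
    using continuous_attains_inf[of "sphere 0 r1" u] continuous_on_subset[OF cont sub] b by auto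
  define B where "B = u z * r1 powr \<beta>"
  have uz: "0 < u z" using z sub pos by blast
  have B: "0 < B" unfolding B_def using uz r1 by simp
  have low: "B * norm x powr - \<beta> \<le> u x" if x: "r1 \<le> norm x" for x
  proof (rule tendsto_upperbound)
    have "((\<lambda>\<rho>. \<rho> powr - \<beta>) \<longlongrightarrow> 0) at_top"
      using \<beta>(1) by (intro tendsto_neg_powr filterlim_ident) auto
    then have "((\<lambda>\<rho>. - (B * \<rho> powr - \<beta>) + B * norm x powr - \<beta>) \<longlongrightarrow> - (B * 0) + B * norm x powr - \<beta>) at_top"
      by (intro tendsto_intros)
    then show "((\<lambda>\<rho>. - (B * \<rho> powr - \<beta>) + B * norm x powr - \<beta>) \<longlongrightarrow> B * norm x powr - \<beta>) at_top" by simp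
    show "\<forall>\<^sub>F \<rho> in at_top. - (B * \<rho> powr - \<beta>) + B * norm x powr - \<beta> \<le> u x"
      using eventually_ge_at_top[of "norm x"]
    proof eventually_elim
      case (elim \<rho>)
      have "- (B * \<rho> powr - \<beta>) + B * norm (x - 0) powr - \<beta> \<le> u x"
      proof (rule annulus_barrier[where rin = r1 and rout = \<rho>])
        show "0 < sgn (B * - \<beta>) * (real DIM('a) + ((- \<beta> - 1) * (r - 1) - 1))" if "r = p \<or> r = q" for r
          using decreasing_barrier_sign[OF B \<beta> that] .
        show "- (B * \<rho> powr - \<beta>) + B * r1 powr - \<beta> \<le> u y" if "norm (y - 0) = r1" for y
        proof -
          have "B * r1 powr - \<beta> = u z" using r1 by (simp add: B_def powr_minus)
          moreover have "0 \<le> B * \<rho> powr - \<beta>" using B by simp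
          ultimately show ?thesis using z(2)[of y] that by simp
        qed
      qed (use r1 B \<beta> nonneg R x elim in auto)
      then show ?case by simp
    qed
  qed simp
  show ?thesis unfolding grows_like_def
    using low B r1 R by (intro exI[of _ B] exI[of _ r1] conjI allI impI) auto
qed

text \<open>A lower bound for \<open>u\<close> improves itself through the term \<open>u\<^sup>s\<^sup>-\<^sup>1\<close>. On the ball of radius
  \<open>\<rho> = |x0| / 2\<close> around \<open>x0\<close> this term is at least of order \<open>\<rho>\<close> to the power \<open>m (s - 1)\<close>. The barrier
  \<open>d - d (|x - x0| / \<rho>)\<^sup>t\<close> vanishes on the boundary, has the value \<open>d\<close> at the centre, and its
  \<open>-\<Delta>\<^sub>r\<close> is of order \<open>d\<^sup>r\<^sup>-\<^sup>1 / \<rho>\<^sup>r\<close>. The hypothesis on \<open>m'\<close> says that \<open>d = k \<rho>\<close> to the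
  power \<open>m'\<close> is admissible for both exponents when \<open>k\<close> is small.\<close>

lemma grows_like_step:
  assumes P: "grows_like m"
    and le: "\<And>r. r = p \<or> r = q \<Longrightarrow> m' * (r - 1) \<le> r + m * (s - 1)"
  shows "grows_like m'"
proof -
  obtain c R where c: "0 < c" and R: "1 \<le> R" "\<And>x. R \<le> norm x \<Longrightarrow> x \<in> \<Omega>" "\<And>x. R \<le> norm x \<Longrightarrow> c * norm x powr m \<le> u x"
    using P unfolding grows_like_def by metis
  define c1 where "c1 = c * min 1 (3 powr m)"
  have c1: "0 < c1" using c by (simp add: c1_def min_def)
  \<comment> \<open>Any exponent above \<open>q / (q - 1)\<close> keeps the flux fields differentiable at the centre.\<close>
  define t where "t = q / (q - 1) + 1"
  have t: "1 < t" "(t - 1) * (q - 1) = q" using q by (auto simp: t_def)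
  define e where "e r = (t - 1) * (r - 1) - 1" for r
  have e: "0 < e r" if "r = p \<or> r = q" for r
  proof -
    have "(t - 1) * (q - 1) \<le> (t - 1) * (r - 1)" using that t qp by (intro mult_left_mono) auto
    then show ?thesis using t(2) q by (simp add: e_def)
  qed
  define M where "M r = t powr (r - 1) * (real DIM('a) + e r)" for r
  have "((\<lambda>k. M p * k powr (p - 1) + M q * k powr (q - 1)) \<longlongrightarrow> M p * 0 powr (p - 1) + M q * 0 powr (q - 1)) (at_right 0)"
    using p q by (intro tendsto_intros) (auto simp: eventually_at_filter)
  then have "((\<lambda>k. M p * k powr (p - 1) + M q * k powr (q - 1)) \<longlongrightarrow> 0) (at_right 0)" by simp
  then have "\<forall>\<^sub>F k in at_right 0. M p * k powr (p - 1) + M q * k powr (q - 1) < c1 powr (s - 1)"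
    using c1 by (intro order_tendstoD(2)) auto
  then have "\<forall>\<^sub>F k in at_right 0. M p * k powr (p - 1) + M q * k powr (q - 1) < c1 powr (s - 1) \<and> 0 < k"
    using eventually_at_right_less[of "0::real"] by eventually_elim simp
  then obtain k where k: "M p * k powr (p - 1) + M q * k powr (q - 1) < c1 powr (s - 1)" "0 < k"
    using eventually_happens'[OF trivial_limit_at_right_real] by blast
  have "k * 2 powr - m' * norm x0 powr m' \<le> u x0" if x0: "2 * R \<le> norm x0" for x0
  proof -
    define \<rho> where "\<rho> = norm x0 / 2"
    have \<rho>: "1 \<le> \<rho>" "R \<le> \<rho>" "0 < \<rho>" using x0 R by (auto simp: \<rho>_def)
    define d where "d = k * \<rho> powr m'"
    have d: "0 < d" using k \<rho> by (simp add: d_def)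
    define B where "B = - (d * \<rho> powr - t)"
    have B: "B < 0" using d \<rho> by (simp add: B_def)
    have Bt: "B * t < 0" using B t by (intro mult_neg_pos) auto
    have low: "c1 * \<rho> powr m \<le> u y" and y\<Omega>: "y \<in> \<Omega>" if y: "norm (y - x0) \<le> \<rho>" for y
    proof -
      have y1: "\<rho> \<le> norm y" "norm y \<le> 3 * \<rho>"
        using y norm_triangle_ineq3[of y x0] norm_triangle_ineq2[of y x0] norm_triangle_ineq2[of x0 y]
        by (auto simp: \<rho>_def norm_minus_commute)
      then show "y \<in> \<Omega>" using R \<rho> by auto
      have "min 1 (3 powr m) * \<rho> powr m \<le> norm y powr m"
      proof (cases "0 \<le> m")
        case True
        have "min 1 (3 powr m) * \<rho> powr m \<le> 1 * \<rho> powr m" by (intro mult_right_mono) auto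
        also have "\<dots> \<le> norm y powr m" using True y1 \<rho> by (simp add: powr_mono2)
        finally show ?thesis .
      next
        case False
        have "min 1 (3 powr m) * \<rho> powr m \<le> 3 powr m * \<rho> powr m" by (intro mult_right_mono) auto
        also have "\<dots> = (3 * \<rho>) powr m" using \<rho> by (simp add: powr_mult)
        also have "\<dots> \<le> norm y powr m" using False y1 \<rho> by (intro powr_mono2') auto
        finally show ?thesis .
      qed
      then have "c1 * \<rho> powr m \<le> c * norm y powr m" using c by (simp add: c1_def mult.assoc)
      also have "\<dots> \<le> u y" using R(3)[of y] y1 \<rho> by auto
      finally show "c1 * \<rho> powr m \<le> u y" .
    qed
    have rhs: "power_barrier_rhs DIM('a) r (B * t) t (norm (y - x0)) \<le> M r * k powr (r - 1) * \<rho> powr (m * (s - 1))"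
      if r: "r = p \<or> r = q" and y: "norm (y - x0) \<le> \<rho>" for r y
    proof -
      have "power_barrier_rhs DIM('a) r (B * t) t (norm (y - x0)) = (t * d * \<rho> powr - t) powr (r - 1) * ((real DIM('a) + e r) * norm (y - x0) powr e r)"
        using Bt by (simp add: power_barrier_rhs_def e_def abs_if B_def mult_ac)
      also have "\<dots> \<le> (t * d * \<rho> powr - t) powr (r - 1) * ((real DIM('a) + e r) * \<rho> powr e r)"
        using e[OF r] y by (intro mult_left_mono powr_mono2) auto
      also have "(t * d * \<rho> powr - t) powr (r - 1) = t powr (r - 1) * k powr (r - 1) * (\<rho> powr m' * \<rho> powr - t) powr (r - 1)"
        using t k \<rho> by (simp add: d_def powr_mult mult_ac)
      also have "(\<rho> powr m' * \<rho> powr - t) powr (r - 1) = \<rho> powr ((m' - t) * (r - 1))"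
        by (simp add: powr_add[symmetric] powr_powr)
      also have "t powr (r - 1) * k powr (r - 1) * \<rho> powr ((m' - t) * (r - 1)) * ((real DIM('a) + e r) * \<rho> powr e r)
          = M r * k powr (r - 1) * \<rho> powr ((m' - t) * (r - 1) + e r)"
        by (simp add: M_def powr_add mult_ac)
      also have "(m' - t) * (r - 1) + e r = m' * (r - 1) - r" by (simp add: e_def algebra_simps)
      also have "M r * k powr (r - 1) * \<rho> powr (m' * (r - 1) - r) \<le> M r * k powr (r - 1) * \<rho> powr (m * (s - 1))"
        using le[OF r] \<rho> e[OF r] by (intro mult_left_mono powr_mono) (auto simp: M_def)
      finally show ?thesis .
    qed
    have "d + B * norm (x0 - x0) powr t \<le> u x0"
    proof (rule power_barrier[where K = "cball x0 \<rho>" and U = "ball x0 \<rho>"])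
      show "cball x0 \<rho> \<subseteq> \<Omega>" using y\<Omega> by (auto simp: dist_norm norm_minus_commute)
      show "x0 \<notin> cball x0 \<rho> \<or> 1 < (t - 1) * (q - 1)" using t q by simp
      show "B * t \<noteq> 0" using Bt by (rule less_imp_neq)
    next
      fix y assume "y \<in> ball x0 \<rho>"
      then have y: "norm (y - x0) \<le> \<rho>" by (simp add: dist_norm norm_minus_commute)
      have "power_barrier_rhs DIM('a) p (B * t) t (norm (y - x0)) + power_barrier_rhs DIM('a) q (B * t) t (norm (y - x0))
        \<le> (M p * k powr (p - 1) + M q * k powr (q - 1)) * \<rho> powr (m * (s - 1))"
        using rhs[OF _ y, of p] rhs[OF _ y, of q] by (simp add: distrib_right)
      also have "\<dots> < c1 powr (s - 1) * \<rho> powr (m * (s - 1))"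
        using k \<rho> by (intro mult_strict_right_mono) auto
      also have "\<dots> = (c1 * \<rho> powr m) powr (s - 1)" using c1 by (simp add: powr_mult powr_powr)
      also have "\<dots> \<le> u y powr (s - 1)" using low[OF y] s c1 by (intro powr_mono2) auto
      finally show "power_barrier_rhs DIM('a) p (B * t) t (norm (y - x0)) + power_barrier_rhs DIM('a) q (B * t) t (norm (y - x0)) < u y powr (s - 1)" .
    next
      fix y assume "y \<in> cball x0 \<rho> - ball x0 \<rho>"
      then have y: "norm (y - x0) = \<rho>" by (auto simp: dist_norm norm_minus_commute)
      then have "0 \<le> u y" using y\<Omega> nonneg by auto
      then show "d + B * norm (y - x0) powr t \<le> u y" unfolding y using \<rho> by (simp add: B_def mult.assoc powr_add[symmetric])
    qed (use \<rho> in auto)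
    then have "d \<le> u x0" by simp
    moreover have "d = k * 2 powr - m' * norm x0 powr m'" by (simp add: d_def \<rho>_def powr_divide powr_minus_divide)
    ultimately show ?thesis by simp
  qed
  moreover have "0 < k * 2 powr - m'" using k by simp
  moreover have "1 \<le> 2 * R" "\<And>x. 2 * R \<le> norm x \<Longrightarrow> x \<in> \<Omega>" using R by auto
  ultimately show ?thesis unfolding grows_like_def by blast
qed

text \<open>The function \<open>B (|x| - R)\<close> is a strict subsolution for every slope \<open>B > 0\<close> and every exponent. It lies below
  a superlinear \<open>u\<close> on a large sphere, so it lies below \<open>u\<close> everywhere outside the ball of radius \<open>R\<close>. Letting
  \<open>B\<close> grow contradicts the finiteness of \<open>u\<close> at a single point.\<close>

lemma not_grows_like_superlinear:
  assumes P: "grows_like m" and m: "1 < m" and N: "1 < real DIM('a)"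
  shows False
proof -
  obtain c R where c: "0 < c" and R: "1 \<le> R" "\<And>x. R \<le> norm x \<Longrightarrow> x \<in> \<Omega>" "\<And>x. R \<le> norm x \<Longrightarrow> c * norm x powr m \<le> u x"
    using P unfolding grows_like_def by metis
  obtain x :: 'a where x: "norm x = R + 1" using vector_choose_size[of "R + 1"] R by auto
  define B where "B = u x + 1"
  have B: "0 < B" using nonneg[of x] R(2)[of x] x by (simp add: B_def)
  define \<rho> where "\<rho> = max (R + 1) ((B / c) powr (1 / (m - 1)))"
  have "B / c = ((B / c) powr (1 / (m - 1))) powr (m - 1)" using m B c by (simp add: powr_powr)
  also have "\<dots> \<le> \<rho> powr (m - 1)" using m by (intro powr_mono2) (auto simp: \<rho>_def)
  finally have \<rho>: "B \<le> c * \<rho> powr (m - 1)" "R + 1 \<le> \<rho>" using c by (auto simp: field_simps \<rho>_def)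
  have "- (B * R) + B * norm (x - 0) powr 1 \<le> u x"
  proof (rule annulus_barrier[where rin = R and rout = \<rho>])
    show "0 < sgn (B * 1) * (real DIM('a) + ((1 - 1) * (r - 1) - 1))" for r using B N by simp
    show "- (B * R) + B * \<rho> powr 1 \<le> u y" if y: "norm (y - 0) = \<rho>" for y
    proof -
      have "B * \<rho> \<le> c * \<rho> powr (m - 1) * \<rho>" using \<rho> R by (intro mult_right_mono) auto
      also have "\<dots> = c * \<rho> powr m" using \<rho> R by (simp add: powr_diff)
      also have "\<dots> \<le> u y" using R(3)[of y] y \<rho> by simp
      finally have "B * \<rho> \<le> u y" .
      moreover have "0 \<le> B * R" "\<rho> powr 1 = \<rho>" using B R \<rho> by auto
      ultimately show ?thesis by simp
    qed
  qed (use R B x \<rho> nonneg in auto)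
  then show False using x R B by (simp add: B_def algebra_simps)
qed

text \<open>The bound on \<open>s\<close> says precisely that the decay rate \<open>\<beta>0 = (N - q) / (q - 1)\<close> satisfies
  \<open>\<beta>0 (s - q) < q\<close>. A slightly larger \<open>\<beta>\<close> still satisfies this and can be reached by barriers. An
  increase of the exponent \<open>m\<close> by \<open>\<delta>\<close> is possible if \<open>\<delta> (r - 1) \<le> r + m (s - r)\<close> for \<open>r = p\<close> and \<open>r = q\<close>. The
  right-hand side is affine in \<open>m\<close>, equal to \<open>s\<close> at \<open>m = 1\<close> and positive at \<open>m = -\<beta>\<close>, so one \<open>\<delta> > 0\<close> works for
  all \<open>m\<close> in between, and finitely many steps lead to superlinear growth.\<close>

lemma no_positive_supersolution:
  assumes R: "\<And>x. R < norm x \<Longrightarrow> x \<in> \<Omega>" and pos: "\<And>x. x \<in> \<Omega> \<Longrightarrow> 0 < u x"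
    and N: "q < real DIM('a)" and sN: "s < q * (real DIM('a) - 1) / (real DIM('a) - q)"
  shows False
proof -
  define N where "N = real DIM('a)"
  define \<beta>0 where "\<beta>0 = (N - q) / (q - 1)"
  have \<beta>0: "0 < \<beta>0" "(\<beta>0 + 1) * (q - 1) = N - 1" using N q by (auto simp: \<beta>0_def N_def field_simps)
  obtain \<beta> where \<beta>: "\<beta>0 < \<beta>" "\<beta> * (s - q) < q"
  proof (cases "s \<le> q")
    case True
    have "(\<beta>0 + 1) * (s - q) \<le> 0" using True \<beta>0 by (intro mult_nonneg_nonpos) auto
    then have "(\<beta>0 + 1) * (s - q) < q" using q by linarith
    then show ?thesis using that[of "\<beta>0 + 1"] by simp
  next
    case False
    have "s * (N - q) < q * (N - 1)" using sN N by (simp add: N_def field_simps)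
    then have "(N - q) * (s - q) < q * (q - 1)" by (simp add: algebra_simps)
    then have "\<beta>0 < q / (s - q)" using False q by (simp add: \<beta>0_def field_simps)
    then obtain \<beta> where "\<beta>0 < \<beta>" "\<beta> < q / (s - q)" using dense by blast
    then show ?thesis using that[of \<beta>] False by (simp add: field_simps)
  qed
  have \<beta>pos: "0 < \<beta>" using \<beta> \<beta>0 by linarith
  have "(\<beta>0 + 1) * (q - 1) < (\<beta> + 1) * (q - 1)" using \<beta> q by (intro mult_strict_right_mono) auto
  then have init: "grows_like (- \<beta>)"
    using \<beta>0 \<beta>pos by (intro grows_like_initial[OF R pos]) (auto simp: N_def)
  define \<mu> where "\<mu> = min s (q - \<beta> * (s - q))"
  have \<mu>: "0 < \<mu>" using s \<beta> by (simp add: \<mu>_def)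
  define \<delta> where "\<delta> = \<mu> / (p - 1)"
  have \<delta>: "0 < \<delta>" using \<mu> p by (simp add: \<delta>_def)
  have step: "grows_like (m + \<delta>)" if "grows_like m" "- \<beta> \<le> m" "m \<le> 1" for m
  proof (rule grows_like_step[OF that(1)])
    fix r assume r: "r = p \<or> r = q"
    then have rr: "q \<le> r" "r \<le> p" using qp by auto
    have "\<delta> * (r - 1) \<le> \<delta> * (p - 1)" using rr \<delta> by (intro mult_left_mono) auto
    also have "\<dots> = \<mu>" using p by (simp add: \<delta>_def)
    also have "\<mu> \<le> r + m * (s - r)"
    proof (cases "r \<le> s")
      case True
      have "q - \<beta> * (s - q) \<le> r - \<beta> * (s - r)"
        using rr \<beta>pos by (simp add: algebra_simps) (metis add_mono mult_left_mono less_imp_le)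
      also have "\<dots> \<le> r + m * (s - r)"
        using mult_right_mono[of "- \<beta>" m "s - r"] that True by simp
      finally show ?thesis by (simp add: \<mu>_def)
    next
      case False
      have "s = r + 1 * (s - r)" by simp
      also have "\<dots> \<le> r + m * (s - r)" using that False by (intro add_left_mono mult_right_mono_neg) auto
      finally show ?thesis by (simp add: \<mu>_def)
    qed
    finally show "(m + \<delta>) * (r - 1) \<le> r + m * (s - 1)" by (simp add: algebra_simps)
  qed
  have it: "(\<exists>m>1. grows_like m) \<or> grows_like (- \<beta> + real n * \<delta>)" for n
  proof (induction n)
    case (Suc n)
    show ?case
    proof (cases "\<exists>m>1. grows_like m")
      case False
      then have g: "grows_like (- \<beta> + real n * \<delta>)" using Suc by blast
      then have "- \<beta> + real n * \<delta> \<le> 1" using False by (meson not_le)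
      then have "grows_like (- \<beta> + real n * \<delta> + \<delta>)" using step[OF g] \<delta> by simp
      then show ?thesis by (simp add: algebra_simps)
    qed simp
  qed (simp add: init)
  obtain n where n: "(1 + \<beta>) / \<delta> < real n" using reals_Archimedean2 by blast
  then have "1 < - \<beta> + real n * \<delta>" using \<delta> by (simp add: field_simps)
  then obtain m where "1 < m" "grows_like m" using it[of n] by blast
  then show False using not_grows_like_superlinear N q by force
qed

end

section \<open>The Liouville theorem\<close>

lemma zero_in_Lp_loc:
  fixes f :: "'a::euclidean_space \<Rightarrow> 'b::euclidean_space"
  assumes "open \<Omega>" "\<And>x. x \<in> \<Omega> \<Longrightarrow> f x = 0"
  shows "f \<in> Lp_loc r \<Omega>"
  unfolding Lp_loc_def
proof (intro CollectI conjI allI impI)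
  have "f \<in> borel_measurable (lebesgue_on \<Omega>) \<longleftrightarrow> (\<lambda>_. 0 :: 'b) \<in> borel_measurable (lebesgue_on \<Omega>)"
    using assms by (intro measurable_cong) (simp add: space_restrict_space)
  then show "f \<in> borel_measurable (lebesgue_on \<Omega>)" by simp
  fix K assume K: "compact K \<and> K \<subseteq> \<Omega>"
  have "integrable (lebesgue_on K) (\<lambda>x. norm (f x) powr r) \<longleftrightarrow> integrable (lebesgue_on K) (\<lambda>x. 0 :: real)"
    using K assms by (intro Bochner_Integration.integrable_cong) (auto simp: space_restrict_space)
  then show "integrable (lebesgue_on K) (\<lambda>x. norm (f x) powr r)" by simp
qed

lemma zero_is_solution:
  fixes u :: "'a::euclidean_space \<Rightarrow> real"
  assumes \<Omega>: "open \<Omega>" and u0: "\<And>x. x \<in> \<Omega> \<Longrightarrow> u x = 0"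
  shows "nonneg_solution p q s \<Omega> u"
proof -
  have L: "u \<in> Lp_loc r \<Omega>" "(\<lambda>_. 0 :: 'a) \<in> Lp_loc r \<Omega>" for r
    using zero_in_Lp_loc[OF \<Omega>, of u] zero_in_Lp_loc[OF \<Omega>, of "\<lambda>_. 0 :: 'a"] u0 by auto
  have 0: "(LINT x:\<Omega>|lebesgue. u x *\<^sub>R F x) = 0" for F :: "'a \<Rightarrow> 'a"
    unfolding set_lebesgue_integral_def by (rule integral_eq_zero_AE) (auto simp: u0 indicator_def)
  have 1: "(LINT x:\<Omega>|lebesgue. u x powr (s - 1) * F x) = 0" for F :: "'a \<Rightarrow> real"
    unfolding set_lebesgue_integral_def by (rule integral_eq_zero_AE) (auto simp: u0 indicator_def)
  have w: "weak_gradient \<Omega> u (\<lambda>_. 0)"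
    unfolding weak_gradient_def using L 0 by simp
  have "continuous_on \<Omega> u" using u0 by (simp cong: continuous_on_cong)
  moreover have "laplacian_form r \<Omega> (\<lambda>_. 0) \<phi> = 0" for r and \<phi> :: "'a \<Rightarrow> real"
    by (simp add: laplacian_form_def)
  ultimately show ?thesis
    unfolding nonneg_solution_def W1p_loc_def using L w u0 1 by auto
qed

theorem theorem1p7:
  fixes p q s :: real and \<Omega> :: "'a::euclidean_space set" and u :: "'a \<Rightarrow> real"
  assumes "1 < q" and "q < p" and "q < real DIM('a)"
    and "exterior_domain \<Omega>"
    and "1 < s" and "s < q * (real DIM('a) - 1) / (real DIM('a) - q)"
  shows "nonneg_solution p q s \<Omega> u \<longleftrightarrow> (\<forall>x\<in>\<Omega>. u x = 0)"
proof
  obtain R where \<Omega>: "open \<Omega>" "connected \<Omega>" and R: "\<And>x. R < norm x \<Longrightarrow> x \<in> \<Omega>"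
    using assms(4) unfolding exterior_domain_def by blast
  show "nonneg_solution p q s \<Omega> u" if "\<forall>x\<in>\<Omega>. u x = 0"
    using zero_is_solution[OF \<Omega>(1)] that by blast
  assume "nonneg_solution p q s \<Omega> u"
  then obtain Du where "pq_supersolution p q s \<Omega> u Du"
    using assms \<Omega>(1) unfolding nonneg_solution_def pq_supersolution_def by blast
  then interpret pq_supersolution p q s \<Omega> u Du .
  show "\<forall>x\<in>\<Omega>. u x = 0"
  proof (rule ccontr)
    assume "\<not> (\<forall>x\<in>\<Omega>. u x = 0)"
    then obtain x1 where x1: "x1 \<in> \<Omega>" "u x1 \<noteq> 0" by blast
    show False
      by (rule no_positive_supersolution[where R = R])
         (erule R, erule strong_maximum_principle[OF \<Omega>(2) x1], rule assms(3), rule assms(6))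
  qed
qed

end
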